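(* Let $t\ge 1$ be an integer, let $n\ge 6(t+4)^4$, and let $\mathcal F\subseteq\Sigma_n$ be $t$-intersecting. Then $$\gamma_t^{\star}(\mathcal F)\le t(n-t-2)(n-t-2)!.$$ Equality holds if and only if there is a partial permutation $X$ of size $t+2$ such that $$\{F\in\Sigma_n:|F\cap X|=t+1\}\subseteq\mathcal F\subseteq\{F\in\Sigma_n:|F\cap X|\ge t+1\}.$$
   Context: $[n]=\{1,\dots,n\}$ and $\Sigma_n$ is the set of all permutations of $[n]$. A permutation $\sigma\in\Sigma_n$ is identified with the $n$-element set $\{(i,\sigma(i)):i\in[n]\}\subset[n]\times[n]$. A family $\mathcal F\subseteq\Sigma_n$ is $t$-intersecting if $|F\cap F'|\ge t$ for all $F,F'\in\mathcal F$. A set $S\subset[n]\times[n]$ is a partial permutation if it is contained in some permutation $\sigma\in\Sigma_n$. The star $t$-diversity of $\mathcal F\subseteq\Sigma_n$ is $$\gamma_t^{\star}(\mathcal F)=\min\{|\{F\in\mathcal F:T\not\subset F\}|: T\text{ is a partial permutation with }|T|=t\},$$ where $T\not\subset F$ means that $T$ is not a subset of $F$. *)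

theory Defs
  imports "HOL-Combinatorics.Permutations"
begin

text \<open>
  A permutation of \<open>[n] = {1..n}\<close> is identified with its graph, so that intersections, inclusions
  and cardinalities below are those of subsets of \<open>[n] \<times> [n]\<close>.
\<close>

definition perm_graph :: "nat \<Rightarrow> (nat \<Rightarrow> nat) \<Rightarrow> (nat \<times> nat) set" where
  "perm_graph n p = {(i, p i) | i. i \<in> {1..n}}"

definition Sigma_perms :: "nat \<Rightarrow> (nat \<times> nat) set set" where
  "Sigma_perms n = {perm_graph n p | p. p permutes {1..n}}"

definition t_intersecting :: "nat \<Rightarrow> 'a set set \<Rightarrow> bool" where
  "t_intersecting t \<F> \<longleftrightarrow> (\<forall>F\<in>\<F>. \<forall>F'\<in>\<F>. t \<le> card (F \<inter> F'))"

definition partial_permutation :: "nat \<Rightarrow> (nat \<times> nat) set \<Rightarrow> bool" where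
  "partial_permutation n S \<longleftrightarrow> (\<exists>F\<in>Sigma_perms n. S \<subseteq> F)"

text \<open>
  The minimum ranges over a finite set, which is nonempty exactly when \<open>t \<le> n\<close>; for \<open>t > n\<close> the
  value is unspecified.
\<close>

definition star_diversity :: "nat \<Rightarrow> nat \<Rightarrow> (nat \<times> nat) set set \<Rightarrow> nat" where
  "star_diversity n t \<F> =
     Min {card {F \<in> \<F>. \<not> T \<subseteq> F} | T. partial_permutation n T \<and> card T = t}"

end

theory Submission
  imports Defs Complex_Main
begin

text \<open>
  The proof is a spread approximation. Let \<open>\<kappa>\<^sup>6 = n\<close>. Every subfamily of \<open>\<F>\<close> has a set \<open>T\<close> for
  which the density of its members among the permutations containing \<open>T\<close>, discounted by
  \<open>\<kappa> ^ card T\<close>, is largest; such a kernel is either of size at most \<open>6 * t + 11\<close>, or the subfamily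
  has at most \<open>(n - t - 2)!\<close> members. Beyond its kernel the subfamily is spread, so a random half of
  the grid contains one of its members with probability above one half (a two-round version of the
  Park--Pham argument). Applying this to two subfamilies and to complementary halves yields two
  members that meet only inside the intersection of the two kernels, so small kernels pairwise meet
  in at least \<open>t\<close> cells. Hence all but \<open>(n - t - 2)!\<close> members of \<open>\<F>\<close> contain a set from a
  \<open>t\<close>-intersecting family of small sets. Branching on covers of that family shows that some star
  omits too few members to matter, unless all small sets meet one partial permutation \<open>X\<close> of size
  \<open>t + 2\<close> in at least \<open>t + 1\<close> cells. In that case a member meeting \<open>X\<close> in at most \<open>t\<close> cells
  forces every member through a suitable \<open>X - {z}\<close> to hit it elsewhere, which destroys a third of
  the possible ones.
\<close>

section \<open>Fragments of spread families\<close>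

text \<open>The target is \<open>t * (n - t - 2)\<close> copies of \<open>fact (n - t - 2)\<close>,
  so an approximation that loses a single \<open>fact (n - t - 2)\<close> is affordable in every
  strict comparison. That loss dictates the constants: a kernel of size at least
  \<open>6 * (t + 2)\<close> forces its subfamily down to n!/\<kappa>^(6(t+2)) = n!/n^(t+2), which
  is at most (n-t-2)!. Hence the sixth root, and the size bound 6t+11 = 6(t+2)-1. Two random rounds
  are enough because extensions of a kernel are measured against factorials: the first round leaves
  fragments of size O(\<kappa>), and for these the union bound of the second round is a geometric
  series in a multiple of \<kappa>^2/n, which is small since \<kappa> is only the sixth root of n.
  The loss cannot be neglected when equality is characterized: a few members could lie far from
  \<open>X\<close>. They are excluded by a cost argument. One such member removes about a third of a
  layer of size roughly (n-t-1)!, far more than the (n-t-2)! that all such members could contribute.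
  The third is 1 - 1 + 1/2 - 1/6, the truncated series of 1/e from counting derangements.\<close>

definition biased_weight :: "real \<Rightarrow> 'a set \<Rightarrow> 'a set \<Rightarrow> real" where
  "biased_weight p E W = p ^ card W * (1 - p) ^ card (E - W)"

lemma biased_weight_nonneg: "0 \<le> p \<Longrightarrow> p \<le> 1 \<Longrightarrow> 0 \<le> biased_weight p E W"
  by (simp add: biased_weight_def)

lemma sum_Pow_weight:
  fixes a b :: real
  assumes "finite E"
  shows "(\<Sum>W\<in>Pow E. a ^ card W * b ^ card (E - W)) = (a + b) ^ card E"
  using prod_add[OF assms, of "\<lambda>_. a" "\<lambda>_. b"] by simp

lemma sum_biased_weight:
  assumes "finite E"
  shows "(\<Sum>W\<in>Pow E. biased_weight p E W) = 1"
  using sum_Pow_weight[OF assms, of p "1 - p"] by (simp add: biased_weight_def)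

text \<open>Each cell moved into the random set costs the odds (1-p)/p. This is the source of the
  factors 3^s (p = 1/4) and 2^s (p = 1/3) in the two rounds.\<close>

lemma biased_weight_union:
  assumes "finite E" "W \<subseteq> E" "U \<subseteq> E" "U \<inter> W = {}" "0 < p"
  shows "biased_weight p E W = biased_weight p E (W \<union> U) * ((1 - p) / p) ^ card U"
proof -
  have fin: "finite W" "finite U"
    using assms finite_subset by blast+
  have "E - W = (E - (W \<union> U)) \<union> U"
    using assms by auto
  then have "card (E - W) = card (E - (W \<union> U)) + card U"
    using assms fin by (metis Diff_disjoint Int_Diff Int_commute Un_Diff_Int card_Un_disjoint finite_Diff inf_sup_absorb sup_commute)
  moreover have "card (W \<union> U) = card W + card U"
    using fin assms by (simp add: card_Un_disjoint Int_commute)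
  ultimately show ?thesis
    using assms by (simp add: biased_weight_def power_add power_divide)
qed

lemma sum_subsets_by_card:
  fixes f :: "nat \<Rightarrow> real"
  assumes "finite A" "card A \<le> k" "\<And>s. 0 \<le> f s"
  shows "(\<Sum>U | U \<subseteq> A \<and> l < card U. f (card U)) \<le> (\<Sum>s=Suc l..k. real (k choose s) * f s)"
proof -
  have fin: "finite {U. U \<subseteq> A \<and> l < card U}"
    using assms(1) by simp
  have img: "card ` {U. U \<subseteq> A \<and> l < card U} \<subseteq> {Suc l..k}"
    using assms(1,2) by (auto dest: card_mono)
  have "(\<Sum>U | U \<subseteq> A \<and> l < card U. f (card U))
      = (\<Sum>s=Suc l..k. \<Sum>U\<in>{U \<in> {U. U \<subseteq> A \<and> l < card U}. card U = s}. f (card U))"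
    using sum.group[OF fin _ img, of "\<lambda>U. f (card U)"] by simp
  also have "\<dots> = (\<Sum>s=Suc l..k. real (card A choose s) * f s)"
  proof (rule sum.cong[OF refl])
    fix s assume "s \<in> {Suc l..k}"
    then have "{U \<in> {U. U \<subseteq> A \<and> l < card U}. card U = s} = {U. U \<subseteq> A \<and> card U = s}"
      by auto
    then show "(\<Sum>U\<in>{U \<in> {U. U \<subseteq> A \<and> l < card U}. card U = s}. f (card U)) = real (card A choose s) * f s"
      by (simp add: n_subsets[OF assms(1)])
  qed
  also have "\<dots> \<le> (\<Sum>s=Suc l..k. real (k choose s) * f s)"
    by (intro sum_mono mult_right_mono) (auto simp: assms binomial_right_mono)
  finally show ?thesis .
qed

text \<open>
  An index counted on the left-hand side has an inclusion-minimal fragment \<open>U = S i' - W\<close> with more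
  than \<open>l\<close> elements inside its set. The pair \<open>(W, U)\<close> is encoded as \<open>(W \<union> U, U)\<close>: any member contained
  in \<open>W \<union> U\<close> must contain \<open>U\<close> by minimality, so fixing one such member in terms of \<open>W \<union> U\<close> leaves
  only its subsets as candidates for \<open>U\<close>.
\<close>

lemma fragment_bound:
  fixes E :: "'a set" and I :: "'i set" and S :: "'i \<Rightarrow> 'a set" and g :: "nat \<Rightarrow> real"
  assumes finE: "finite E" and finI: "finite I"
    and S: "\<And>i. i \<in> I \<Longrightarrow> S i \<subseteq> E" "\<And>i. i \<in> I \<Longrightarrow> card (S i) \<le> k"
    and spread: "\<And>U. U \<subseteq> E \<Longrightarrow> card U \<le> k \<Longrightarrow> real (card {i \<in> I. U \<subseteq> S i}) \<le> g (card U)"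
    and g: "\<And>s. 0 \<le> g s"
    and p: "0 < p" "p < 1"
  shows "(\<Sum>W\<in>Pow E. biased_weight p E W *
            real (card {i \<in> I. \<forall>i'\<in>I. S i' - W \<subseteq> S i \<longrightarrow> l < card (S i' - W)}))
        \<le> (\<Sum>s=Suc l..k. real (k choose s) * (((1 - p) / p) ^ s * g s))"
proof -
  define \<U> where "\<U> W = {U. l < card U \<and> (\<exists>i\<in>I. U = S i - W) \<and> (\<forall>i\<in>I. S i - W \<subseteq> U \<longrightarrow> S i - W = U)}" for W
  \<comment> \<open>The default \<open>{}\<close> keeps the bounds on \<open>host Z\<close> valid
    for sets \<open>Z\<close> that contain no member.\<close>
  define host where "host Z = (if \<exists>i\<in>I. S i \<subseteq> Z then S (SOME i. i \<in> I \<and> S i \<subseteq> Z) else {})" for Z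
  have host: "host Z \<subseteq> E" "card (host Z) \<le> k" for Z
  proof -
    have "host Z = {} \<or> (\<exists>i\<in>I. host Z = S i)"
      unfolding host_def by (metis (mono_tags, lifting) someI_ex)
    then show "host Z \<subseteq> E" "card (host Z) \<le> k"
      using S by auto
  qed
  have finS: "finite (S i)" if "i \<in> I" for i
    using S(1)[OF that] finE finite_subset by blast
  have \<U>E: "U \<subseteq> E" "U \<inter> W = {}" "card U \<le> k" if "U \<in> \<U> W" for U W
  proof -
    obtain i where "i \<in> I" "U = S i - W"
      using \<open>U \<in> \<U> W\<close> unfolding \<U>_def by auto
    then show "U \<subseteq> E" "U \<inter> W = {}" "card U \<le> k"
      using S[of i] card_mono[OF finS[of i], of U] by auto
  qed
  have fin\<U>: "finite (\<U> W)" for W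
    using \<U>E(1) finite_subset[of "\<U> W" "Pow E"] finE by auto
  have in_host: "U \<subseteq> host (W \<union> U)" if U: "U \<in> \<U> W" for U W
  proof -
    obtain i where i: "i \<in> I" "U = S i - W"
      using U unfolding \<U>_def by auto
    then have ex: "\<exists>i\<in>I. S i \<subseteq> W \<union> U"
      by auto
    define j where "j = (SOME i. i \<in> I \<and> S i \<subseteq> W \<union> U)"
    have j: "j \<in> I" "S j \<subseteq> W \<union> U"
      using someI_ex[of "\<lambda>i. i \<in> I \<and> S i \<subseteq> W \<union> U"] ex unfolding j_def by auto
    then have "S j - W \<subseteq> U"
      by auto
    then have "S j - W = U"
      using U j(1) unfolding \<U>_def by blast
    moreover have "host (W \<union> U) = S j"
      using ex unfolding host_def j_def by simp
    ultimately show ?thesis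
      by auto
  qed
  have bad: "real (card {i \<in> I. \<forall>i'\<in>I. S i' - W \<subseteq> S i \<longrightarrow> l < card (S i' - W)})
      \<le> (\<Sum>U\<in>\<U> W. g (card U))" (is "real (card ?B) \<le> _") for W
  proof -
    have "?B \<subseteq> (\<Union>U\<in>\<U> W. {i \<in> I. U \<subseteq> S i})"
    proof
      fix i assume i: "i \<in> ?B"
      define C where "C = {i' \<in> I. S i' - W \<subseteq> S i}"
      have C: "finite C" "i \<in> C"
        using i finI unfolding C_def by auto
      define i' where "i' = arg_min_on (\<lambda>i. card (S i - W)) C"
      have i': "i' \<in> C" and least: "\<And>j. j \<in> C \<Longrightarrow> card (S i' - W) \<le> card (S j - W)"
        using arg_min_if_finite(1)[OF C(1), of "\<lambda>i. card (S i - W)"]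
          arg_min_least[OF C(1), of _ "\<lambda>i. card (S i - W)"] C unfolding i'_def by auto
      have "S i' - W \<in> \<U> W"
        unfolding \<U>_def
      proof (intro CollectI conjI ballI impI)
        show "l < card (S i' - W)"
          using i i' unfolding C_def by auto
        show "\<exists>i\<in>I. S i' - W = S i - W"
          using i' unfolding C_def by auto
        fix j assume j: "j \<in> I" "S j - W \<subseteq> S i' - W"
        then have "j \<in> C"
          using i' unfolding C_def by auto
        then show "S j - W = S i' - W"
          using least j(2) card_subset_eq[of "S i' - W" "S j - W"] card_mono[OF _ j(2)] finS[of i'] i'
          unfolding C_def by (simp add: order_antisym)
      qed
      then show "i \<in> (\<Union>U\<in>\<U> W. {i \<in> I. U \<subseteq> S i})"
        using i i' unfolding C_def by auto
    qed
    then have "card ?B \<le> card (\<Union>U\<in>\<U> W. {i \<in> I. U \<subseteq> S i})"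
      using finI fin\<U> by (intro card_mono) auto
    also have "\<dots> \<le> (\<Sum>U\<in>\<U> W. card {i \<in> I. U \<subseteq> S i})"
      by (rule card_UN_le[OF fin\<U>])
    finally have "real (card ?B) \<le> (\<Sum>U\<in>\<U> W. real (card {i \<in> I. U \<subseteq> S i}))"
      by (simp flip: of_nat_sum)
    also have "\<dots> \<le> (\<Sum>U\<in>\<U> W. g (card U))"
      by (intro sum_mono spread \<U>E(1,3))
    finally show ?thesis .
  qed
  define h where "h = (\<lambda>(Z :: 'a set, U :: 'a set). biased_weight p E Z * (((1 - p) / p) ^ card U * g (card U)))"
  have wnn: "0 \<le> biased_weight p E W" for W
    using p by (intro biased_weight_nonneg) auto
  have hnn: "0 \<le> h x" for x
    using wnn g p unfolding h_def by (cases x) auto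
  let ?T = "SIGMA Z:Pow E. {U. U \<subseteq> host Z \<and> l < card U}"
  have finhost: "finite (host Z)" for Z
    using host(1) finE finite_subset by blast
  have finT: "finite ?T"
    using finE finhost by (intro finite_SigmaI) auto
  have "(\<Sum>W\<in>Pow E. biased_weight p E W *
            real (card {i \<in> I. \<forall>i'\<in>I. S i' - W \<subseteq> S i \<longrightarrow> l < card (S i' - W)}))
      \<le> (\<Sum>W\<in>Pow E. biased_weight p E W * (\<Sum>U\<in>\<U> W. g (card U)))"
    by (intro sum_mono mult_left_mono bad wnn)
  also have "\<dots> = (\<Sum>W\<in>Pow E. \<Sum>U\<in>\<U> W. h (W \<union> U, U))"
    unfolding sum_distrib_left h_def
    using biased_weight_union[OF finE _ \<U>E(1) \<U>E(2) p(1)]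
    by (intro sum.cong refl) auto
  also have "\<dots> = (\<Sum>(W, U)\<in>(SIGMA W:Pow E. \<U> W). h (W \<union> U, U))"
    using finE fin\<U> by (intro sum.Sigma) auto
  also have "\<dots> = (\<Sum>x\<in>(\<lambda>(W, U). (W \<union> U, U)) ` (SIGMA W:Pow E. \<U> W). h x)"
  proof -
    have "inj_on (\<lambda>(W, U). (W \<union> U, U)) (SIGMA W:Pow E. \<U> W)"
    proof (rule inj_on_inverseI[where g = "\<lambda>(Z, U). (Z - U, U)"])
      fix x assume "x \<in> (SIGMA W:Pow E. \<U> W)"
      then have "snd x \<inter> fst x = {}"
        using \<U>E(2)[of "snd x" "fst x"] by auto
      then show "(\<lambda>(Z, U). (Z - U, U)) ((\<lambda>(W, U). (W \<union> U, U)) x) = x"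
        by (cases x) auto
    qed
    from sum.reindex[OF this, of h] show ?thesis
      by (simp add: case_prod_beta)
  qed
  also have "\<dots> \<le> (\<Sum>x\<in>?T. h x)"
  proof (rule sum_mono2[OF finT])
    show "(\<lambda>(W, U). (W \<union> U, U)) ` (SIGMA W:Pow E. \<U> W) \<subseteq> ?T"
    proof
      fix x assume "x \<in> (\<lambda>(W, U). (W \<union> U, U)) ` (SIGMA W:Pow E. \<U> W)"
      then obtain W U where "x = (W \<union> U, U)" "W \<subseteq> E" "U \<in> \<U> W"
        by auto
      then show "x \<in> ?T"
        using \<U>E(1)[of U W] in_host[of U W] unfolding \<U>_def by auto
    qed
  qed (rule hnn)
  also have "\<dots> = (\<Sum>Z\<in>Pow E. biased_weight p E Z *
      (\<Sum>U | U \<subseteq> host Z \<and> l < card U. ((1 - p) / p) ^ card U * g (card U)))"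
    unfolding sum_distrib_left h_def
    by (rule sum.Sigma[symmetric]) (use finE finhost in auto)
  also have "\<dots> \<le> (\<Sum>Z\<in>Pow E. biased_weight p E Z *
      (\<Sum>s=Suc l..k. real (k choose s) * (((1 - p) / p) ^ s * g s)))"
    using p g by (intro sum_mono mult_left_mono wnn sum_subsets_by_card[OF finhost host(2)]) auto
  also have "\<dots> = (\<Sum>s=Suc l..k. real (k choose s) * (((1 - p) / p) ^ s * g s))"
    by (simp add: sum_distrib_right[symmetric] sum_biased_weight[OF finE])
  finally show ?thesis .
qed

text \<open>Since \<open>(1 - 1/4) * (1 - 1/3) = 1/2\<close>, the union of the two rounds is a uniformly random subset.\<close>

lemma sum_biased_weight_two_rounds:
  fixes f :: "'a set \<Rightarrow> real"
  assumes finE: "finite E"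
  shows "(\<Sum>V\<in>Pow E. biased_weight (1/4) E V *
            (\<Sum>W\<in>Pow (E - V). biased_weight (1/3) (E - V) W * f (V \<union> W)))
       = (\<Sum>W\<in>Pow E. f W) / 2 ^ card E"
proof -
  \<comment> \<open>A cell of \<open>W\<close> has weight 1/4 whether it comes in the first round or
    in the second (3/4 * 1/3); a cell outside has 3/4 * 2/3 = 1/2. Summing over all \<open>V\<close>
    inside \<open>W\<close> then turns 1/4 + 1/4 into 1/2 per cell of \<open>W\<close>.\<close>
  have eq: "biased_weight (1/4) E V * biased_weight (1/3) (E - V) (W - V)
      = ((1/4) ^ card V * (1/4) ^ card (W - V)) * (1/2) ^ card (E - W)"
    if "V \<subseteq> W" "W \<subseteq> E" for V W
  proof -
    have "E - V - (W - V) = E - W" "E - V = (W - V) \<union> (E - W)" "(W - V) \<inter> (E - W) = {}"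
      using that by auto
    moreover have "finite (W - V)" "finite (E - W)"
      using finE that finite_subset by blast+
    ultimately have "card (E - V) = card (W - V) + card (E - W)" "E - V - (W - V) = E - W"
      by (simp_all add: card_Un_disjoint)
    then have "biased_weight (1/4) E V * biased_weight (1/3) (E - V) (W - V)
      = (1/4) ^ card V * ((3/4) ^ card (W - V) * (1/3) ^ card (W - V))
          * ((3/4) ^ card (E - W) * (2/3) ^ card (E - W))"
      by (simp add: biased_weight_def power_add)
    also have "\<dots> = ((1/4) ^ card V * (1/4) ^ card (W - V)) * (1/2) ^ card (E - W)"
      by (simp flip: power_mult_distrib)
    finally show ?thesis .
  qed
  have "(\<Sum>V\<in>Pow E. biased_weight (1/4) E V *
            (\<Sum>W\<in>Pow (E - V). biased_weight (1/3) (E - V) W * f (V \<union> W)))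
      = (\<Sum>(V, W)\<in>(SIGMA V:Pow E. Pow (E - V)).
           biased_weight (1/4) E V * (biased_weight (1/3) (E - V) W * f (V \<union> W)))"
    unfolding sum_distrib_left by (rule sum.Sigma) (use finE in auto)
  also have "\<dots> = (\<Sum>(W, V)\<in>(SIGMA W:Pow E. Pow W).
           biased_weight (1/4) E V * (biased_weight (1/3) (E - V) (W - V) * f W))"
  proof (rule sum.reindex_bij_witness[of _ "\<lambda>(W, V). (V, W - V)" "\<lambda>(V, W). (V \<union> W, V)"], goal_cases)
    case (5 x)
    then have "(fst x \<union> snd x) - fst x = snd x"
      by auto
    then show ?case
      by (simp add: case_prod_beta)
  qed auto
  also have "\<dots> = (\<Sum>W\<in>Pow E. \<Sum>V\<in>Pow W.
           biased_weight (1/4) E V * (biased_weight (1/3) (E - V) (W - V) * f W))"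
    by (rule sum.Sigma[symmetric]) (use finE finite_subset in auto)
  also have "\<dots> = (\<Sum>W\<in>Pow E. (\<Sum>V\<in>Pow W. (1/4) ^ card V * (1/4) ^ card (W - V)) * ((1/2) ^ card (E - W) * f W))"
    unfolding sum_distrib_right mult.assoc[symmetric] using eq
    by (intro sum.cong refl) (auto simp: mult.assoc)
  also have "\<dots> = (\<Sum>W\<in>Pow E. f W / 2 ^ card E)"
  proof (rule sum.cong[OF refl])
    fix W assume W: "W \<in> Pow E"
    then have fin: "finite W"
      using finE finite_subset by auto
    have "card E = card W + card (E - W)"
      using W finE by (metis PowD card_Diff_subset card_mono fin le_add_diff_inverse)
    moreover have "(\<Sum>V\<in>Pow W. (1/4::real) ^ card V * (1/4) ^ card (W - V)) = (1/2) ^ card W"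
      using sum_Pow_weight[OF fin, of "1/4" "1/4"] by simp
    ultimately show "(\<Sum>V\<in>Pow W. (1/4::real) ^ card V * (1/4) ^ card (W - V)) * ((1/2) ^ card (E - W) * f W)
        = f W / 2 ^ card E"
      by (simp add: power_add power_one_over)
  qed
  finally show ?thesis
    by (simp add: sum_divide_distrib)
qed

text \<open>The first round \<open>V\<close> leaves most indices with a fragment of size at most
  \<open>l\<close> inside their own set; the second round is applied to these fragments with
  threshold 0. If the union of both rounds contains no member, every index is bad in one of the
  rounds, so \<open>card I\<close> is at most the number of bad indices, and taking expectations
  gives the bound.\<close>

lemma uncovered_bound:
  fixes E :: "'a set" and I :: "'i set" and S :: "'i \<Rightarrow> 'a set" and g :: "nat \<Rightarrow> real"
  assumes finE: "finite E" and finI: "finite I"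
    and S: "\<And>i. i \<in> I \<Longrightarrow> S i \<subseteq> E" "\<And>i. i \<in> I \<Longrightarrow> card (S i) \<le> k"
    and spread: "\<And>U. U \<subseteq> E \<Longrightarrow> card U \<le> k \<Longrightarrow> real (card {i \<in> I. U \<subseteq> S i}) \<le> g (card U)"
    and g: "\<And>s. 0 \<le> g s"
    and "l \<le> k"
  shows "real (card {W \<in> Pow E. \<forall>i\<in>I. \<not> S i \<subseteq> W}) * real (card I)
       \<le> 2 ^ card E * ((\<Sum>s=Suc l..k. real (k choose s) * (3 ^ s * g s))
                       + (\<Sum>s=Suc 0..l. real (l choose s) * (2 ^ s * g s)))"
proof -
  define f :: "'a set \<Rightarrow> real" where "f W = (if \<forall>i\<in>I. \<not> S i \<subseteq> W then 1 else 0)" for W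
  define Bad where "Bad V = {i \<in> I. \<forall>i'\<in>I. S i' - V \<subseteq> S i \<longrightarrow> l < card (S i' - V)}" for V
  define rest where "rest = (\<Sum>s=Suc 0..l. real (l choose s) * (2 ^ s * g s))"
  have wnn: "0 \<le> biased_weight (1/4) E V" for V
    by (intro biased_weight_nonneg) auto
  have inner: "(\<Sum>W\<in>Pow (E - V). biased_weight (1/3) (E - V) W * f (V \<union> W)) * real (card I)
      \<le> real (card (Bad V)) + rest" for V
  proof -
    define J where "J = I - Bad V"
    have "\<forall>i\<in>J. \<exists>i'\<in>I. S i' - V \<subseteq> S i \<and> card (S i' - V) \<le> l"
      unfolding J_def Bad_def by (auto simp: not_less)
    then obtain h where h: "\<And>i. i \<in> J \<Longrightarrow> h i \<in> I \<and> S (h i) - V \<subseteq> S i \<and> card (S (h i) - V) \<le> l"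
      by metis
    \<comment> \<open>Different indices may receive the same fragment, hence families indexed by
      \<open>I\<close> rather than sets of sets. As \<open>R i\<close> lies inside
      \<open>S i\<close> for the same index \<open>i\<close>, the spread bound \<open>g\<close> is
      inherited without loss.\<close>
    define R where "R i = S (h i) - V" for i
    define Bad' where "Bad' W = {i \<in> J. \<forall>i'\<in>J. R i' - W \<subseteq> R i \<longrightarrow> 0 < card (R i' - W)}" for W
    have JI: "J \<subseteq> I"
      unfolding J_def by auto
    have "(\<Sum>W\<in>Pow (E - V). biased_weight (1/3) (E - V) W * real (card (Bad' W)))
        \<le> (\<Sum>s=Suc 0..l. real (l choose s) * (((1 - 1/3) / (1/3)) ^ s * g s))"
      unfolding Bad'_def
    proof (rule fragment_bound)
      show "finite (E - V)" "finite J"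
        using finE finI JI finite_subset by auto
      fix i assume "i \<in> J"
      then show "R i \<subseteq> E - V" "card (R i) \<le> l"
        using h S(1) unfolding R_def by blast+
    next
      fix U assume U: "U \<subseteq> E - V" "card U \<le> l"
      have "card {i \<in> J. U \<subseteq> R i} \<le> card {i \<in> I. U \<subseteq> S i}"
        using h JI finI unfolding R_def by (intro card_mono) auto
      also have "real \<dots> \<le> g (card U)"
        using U \<open>l \<le> k\<close> by (intro spread) auto
      finally show "real (card {i \<in> J. U \<subseteq> R i}) \<le> g (card U)"
        by simp
    qed (use g in auto)
    then have *: "(\<Sum>W\<in>Pow (E - V). biased_weight (1/3) (E - V) W * real (card (Bad' W))) \<le> rest"
      unfolding rest_def by simp
    have Iform: "real (card I) = real (card (Bad V)) + real (card J)"
      unfolding J_def using finI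
      by (subst card_Diff_subset) (auto simp: Bad_def of_nat_diff card_mono)
    \<comment> \<open>When \<open>V \<union> W\<close> contains no member, no fragment
      \<open>R i\<close> lies inside \<open>W\<close>, so all of \<open>J\<close> is bad in the
      second round.\<close>
    have "f (V \<union> W) * real (card I) \<le> real (card (Bad V)) + real (card (Bad' W))" for W
    proof (cases "f (V \<union> W) = 0")
      case False
      then have "\<forall>i\<in>I. \<not> S i \<subseteq> V \<union> W" "f (V \<union> W) = 1"
        unfolding f_def by (auto split: if_splits)
      have "0 < card (R i - W)" if "i \<in> J" for i
      proof -
        have "R i - W \<noteq> {}"
          using h[OF that] \<open>\<forall>i\<in>I. \<not> S i \<subseteq> V \<union> W\<close> unfolding R_def by blast
        moreover have "S (h i) \<subseteq> E"
          using h[OF that] S(1) by auto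
        then have "finite (R i - W)"
          using finE finite_subset[of "R i - W" E] unfolding R_def by auto
        ultimately show ?thesis
          by (simp add: card_gt_0_iff)
      qed
      then have "Bad' W = J"
        unfolding Bad'_def by auto
      then show ?thesis
        using Iform \<open>f (V \<union> W) = 1\<close> by simp
    qed auto
    then have "(\<Sum>W\<in>Pow (E - V). biased_weight (1/3) (E - V) W * (f (V \<union> W) * real (card I)))
        \<le> (\<Sum>W\<in>Pow (E - V). biased_weight (1/3) (E - V) W * (real (card (Bad V)) + real (card (Bad' W))))"
      by (intro sum_mono mult_left_mono biased_weight_nonneg) auto
    also have "\<dots> = real (card (Bad V))
        + (\<Sum>W\<in>Pow (E - V). biased_weight (1/3) (E - V) W * real (card (Bad' W)))"
      using sum_biased_weight[of "E - V" "1/3"] finE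
      by (simp add: distrib_left sum.distrib flip: sum_distrib_right)
    finally show ?thesis
      using * by (simp add: sum_distrib_right mult.assoc)
  qed
  have "real (card {W \<in> Pow E. \<forall>i\<in>I. \<not> S i \<subseteq> W}) = (\<Sum>W\<in>Pow E. f W)"
    unfolding f_def using finE by (simp add: sum.If_cases Int_def)
  then have "real (card {W \<in> Pow E. \<forall>i\<in>I. \<not> S i \<subseteq> W}) * real (card I)
      = 2 ^ card E * ((\<Sum>V\<in>Pow E. biased_weight (1/4) E V *
            (\<Sum>W\<in>Pow (E - V). biased_weight (1/3) (E - V) W * f (V \<union> W))) * real (card I))"
    by (simp add: sum_biased_weight_two_rounds[OF finE])
  also have "\<dots> \<le> 2 ^ card E * (\<Sum>V\<in>Pow E. biased_weight (1/4) E V * (real (card (Bad V)) + rest))"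
    unfolding sum_distrib_right mult.assoc
    by (intro mult_left_mono sum_mono) (use inner wnn in \<open>auto simp: sum_distrib_right mult.assoc\<close>)
  also have "\<dots> = 2 ^ card E * ((\<Sum>V\<in>Pow E. biased_weight (1/4) E V * real (card (Bad V))) + rest)"
    using sum_biased_weight[OF finE, of "1/4"] by (simp add: distrib_left sum.distrib flip: sum_distrib_right)
  also have "\<dots> \<le> 2 ^ card E * ((\<Sum>s=Suc l..k. real (k choose s) * (((1 - 1/4) / (1/4)) ^ s * g s)) + rest)"
    unfolding Bad_def
    by (intro mult_left_mono add_right_mono fragment_bound) (use assms in auto)
  finally show ?thesis
    by (simp add: rest_def)
qed

section \<open>Explicit constants for the two rounds\<close>

lemma power_div_fact_le_exp:
  fixes x :: real
  assumes "0 \<le> x"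
  shows "x ^ s / fact s \<le> exp x"
proof -
  have "(\<Sum>n\<in>{s}. x ^ n /\<^sub>R fact n) \<le> (\<Sum>n. x ^ n /\<^sub>R fact n)"
    using assms by (intro sum_le_suminf summable_exp_generic) auto
  then show ?thesis
    by (simp add: exp_def divide_inverse mult.commute)
qed

text \<open>From s^s / s! <= e^s <= 3^s: replacing y by s/4 leaves (3/4)^s.\<close>

lemma power_div_fact_le:
  fixes y :: real
  assumes "0 \<le> y" "4 * y \<le> real s"
  shows "y ^ s / fact s \<le> (3/4) ^ s"
proof -
  have "real s ^ s / fact s \<le> exp (real s)"
    by (rule power_div_fact_le_exp) simp
  also have "\<dots> = exp 1 ^ s"
    by (simp add: exp_of_nat_mult[symmetric])
  also have "\<dots> \<le> 3 ^ s"
    using exp_le by (intro power_mono) auto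
  finally have s: "real s ^ s / fact s \<le> 3 ^ s" .
  have "y ^ s / fact s \<le> (real s / 4) ^ s / fact s"
    using assms by (intro divide_right_mono power_mono) auto
  also have "\<dots> = (real s ^ s / fact s) / 4 ^ s"
    by (simp add: power_divide)
  also have "\<dots> \<le> 3 ^ s / 4 ^ s"
    using s by (intro divide_right_mono) auto
  finally show ?thesis
    by (simp add: power_divide)
qed

lemma sum_power_atLeastAtMost_le:
  fixes x :: real
  assumes "0 \<le> x" "x < 1"
  shows "(\<Sum>s=a..b. x ^ s) \<le> x ^ a / (1 - x)"
proof (cases "a \<le> b")
  case True
  have "(\<Sum>s=a..b. x ^ s) * (1 - x) = x ^ a - x ^ Suc b"
    using sum_gp_multiplied[OF True, of x] by (simp add: mult.commute)
  then show ?thesis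
    using assms by (simp add: pos_le_divide_eq)
qed (use assms in auto)

text \<open>The left side is a quotient of falling factorials of \<open>l\<close> and
  \<open>m\<close>, divided by s!. Each of the \<open>s\<close> quotients (l-i)/(m-i) is at most l/m
  because l <= m.\<close>

lemma choose_mult_fact_le:
  assumes "s \<le> l" "l \<le> m" "0 < m"
  shows "real (l choose s) * (fact (m - s) / fact m) \<le> (real l / real m) ^ s"
  using assms(1)
proof (induction s)
  case (Suc s)
  have step: "real (l choose Suc s) * (fact (m - Suc s) / fact m)
      = (real (l choose s) * (fact (m - s) / fact m)) * (real (l - s) / (real (m - s) * real (Suc s)))"
  proof -
    have "(l choose Suc s) * Suc s = (l choose s) * (l - s)"
      using binomial_absorb_comp[of l s] binomial_absorption[of s l]
      by (metis Suc_times_binomial_eq binomial_absorb_comp mult.commute)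
    then have "real (l choose Suc s) = real (l choose s) * real (l - s) / real (Suc s)"
      by (metis nonzero_mult_div_cancel_right of_nat_0_eq_iff of_nat_mult old.nat.distinct(2))
    moreover have "(fact (m - s) :: real) = real (m - s) * fact (m - Suc s)"
      using Suc.prems assms by (metis Suc_diff_Suc Suc_le_lessD diff_Suc_Suc fact_Suc less_le_trans)
    moreover have "real (m - s) \<noteq> 0"
      using Suc.prems assms by auto
    moreover have "a * (r / F) = x * (f / F) * (y / (q * z))"
      if "a = x * y / z" "f = q * r" "q \<noteq> 0" for a r F x f y q z :: real
      using that by (simp add: mult.commute)
    ultimately show ?thesis
      by blast
  qed
  have "real (l - s) * real m \<le> real l * real (m - s)"
    using Suc.prems assms by (simp add: of_nat_diff algebra_simps mult_right_mono)
  then have "real (l - s) / real (m - s) \<le> real l / real m"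
    using Suc.prems assms by (simp add: divide_simps)
  moreover have "real (l - s) / real (m - s) / real (Suc s) \<le> real (l - s) / real (m - s) / 1"
    by (intro divide_left_mono) auto
  ultimately have "real (l - s) / real (m - s) / real (Suc s) \<le> real l / real m"
    unfolding div_by_1 by (rule order_trans[rotated])
  then show ?case
    unfolding step power_Suc2 divide_divide_eq_left
    by (intro mult_mono Suc.IH) (use Suc.prems in auto)
qed simp

text \<open>For large fragments the factorials cancel the binomial coefficient and leave
  (3\<kappa>)^s/s!, free of \<open>m\<close>. For small ones the summand is at most (2\<kappa>l/m)^s
  with 2\<kappa>l/m <= 24\<kappa>^2/m <= 3/25, which needs \<open>m\<close> quadratic in \<kappa>;
  the series sums to (3/25)/(22/25) = 3/22. Finally (1/10 + 3/22)/(9/10) is below 1/2.\<close>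

lemma uncovered_lt_half:
  fixes E :: "'a set" and I :: "'i set" and S :: "'i \<Rightarrow> 'a set" and M \<kappa> :: real
  assumes finE: "finite E" and finI: "finite I"
    and S: "\<And>i. i \<in> I \<Longrightarrow> S i \<subseteq> E" "\<And>i. i \<in> I \<Longrightarrow> card (S i) \<le> m"
    and spread: "\<And>U. U \<subseteq> E \<Longrightarrow> card U \<le> m \<Longrightarrow>
      real (card {i \<in> I. U \<subseteq> S i}) \<le> M * (\<kappa> ^ card U * (fact (m - card U) / fact m))"
    and M: "0 < M" "9 / 10 * M \<le> real (card I)"
    and \<kappa>: "3 \<le> \<kappa>" "200 * \<kappa>\<^sup>2 \<le> real m"
  shows "2 * card {W \<in> Pow E. \<forall>i\<in>I. \<not> S i \<subseteq> W} < 2 ^ card E"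
proof -
  \<comment> \<open>12\<kappa> is four times 3\<kappa>: beyond \<open>l\<close> the estimate y^s/s!
    <= (3/4)^s applies with y = 3\<kappa>.\<close>
  define l where "l = nat \<lfloor>12 * \<kappa>\<rfloor>"
  have l: "real l \<le> 12 * \<kappa>" "12 * \<kappa> < real (Suc l)"
    unfolding l_def using \<kappa> by linarith+
  have "3 * \<kappa> \<le> \<kappa>\<^sup>2"
    unfolding power2_eq_square using \<kappa> by (intro mult_right_mono) auto
  then have lm: "l \<le> m" "0 < m"
    using l \<kappa> by linarith+
  define g where "g s = M * (\<kappa> ^ s * (fact (m - s) / fact m))" for s
  have "real (card {W \<in> Pow E. \<forall>i\<in>I. \<not> S i \<subseteq> W}) * real (card I)
       \<le> 2 ^ card E * ((\<Sum>s=Suc l..m. real (m choose s) * (3 ^ s * g s))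
                       + (\<Sum>s=Suc 0..l. real (l choose s) * (2 ^ s * g s)))"
    using assms lm by (intro uncovered_bound) (auto simp: g_def)
  also have "(\<Sum>s=Suc l..m. real (m choose s) * (3 ^ s * g s)) \<le> M / 10"
  proof -
    have "real (m choose s) * (3 ^ s * g s) \<le> M * (3/4) ^ s" if "s \<in> {Suc l..m}" for s
    proof -
      have "real (m choose s) * (3 ^ s * g s) = M * ((3 * \<kappa>) ^ s / fact s)"
        using that by (simp add: g_def binomial_fact power_mult_distrib)
      also have "\<dots> \<le> M * (3/4) ^ s"
        using that l \<kappa> M by (intro mult_left_mono power_div_fact_le) auto
      finally show ?thesis .
    qed
    then have "(\<Sum>s=Suc l..m. real (m choose s) * (3 ^ s * g s)) \<le> M * (\<Sum>s=Suc l..m. (3/4) ^ s)"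
      unfolding sum_distrib_left by (intro sum_mono)
    also have "\<dots> \<le> M * ((3/4) ^ Suc l / (1 - 3/4))"
      using M by (intro mult_left_mono sum_power_atLeastAtMost_le) auto
    \<comment> \<open>Since \<kappa> >= 3, \<open>Suc l\<close> exceeds 36; the exponent 16 already
      brings 4 * (3/4)^16 below 1/10.\<close>
    also have "\<dots> \<le> M * ((3/4) ^ 16 / (1 - 3/4))"
      using M l \<kappa> by (intro mult_left_mono divide_right_mono power_decreasing) auto
    also have "\<dots> \<le> M * (1 / 10)"
      using M by (intro mult_left_mono) (auto simp: power_divide)
    finally show ?thesis
      by simp
  qed
  also have "(\<Sum>s=Suc 0..l. real (l choose s) * (2 ^ s * g s)) \<le> M * (3 / 22)"
  proof -
    define x where "x = 2 * \<kappa> * (real l / real m)"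
    have x: "0 \<le> x"
      unfolding x_def using \<kappa> by auto
    have "x \<le> 2 * \<kappa> * (12 * \<kappa> / real m)"
      unfolding x_def using \<kappa> l by (intro mult_left_mono divide_right_mono) auto
    also have "\<dots> \<le> 3 / 25"
      using \<kappa> lm by (simp add: field_simps power2_eq_square)
    finally have x': "x \<le> 3 / 25" .
    have "real (l choose s) * (2 ^ s * g s) \<le> M * x ^ s" if "s \<in> {Suc 0..l}" for s
    proof -
      have "real (l choose s) * (2 ^ s * g s)
          = M * ((2 * \<kappa>) ^ s * (real (l choose s) * (fact (m - s) / fact m)))"
        by (simp add: g_def power_mult_distrib)
      also have "\<dots> \<le> M * ((2 * \<kappa>) ^ s * (real l / real m) ^ s)"
        using that lm \<kappa> M by (intro mult_left_mono choose_mult_fact_le) auto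
      also have "\<dots> = M * x ^ s"
        unfolding x_def power_mult_distrib ..
      finally show ?thesis .
    qed
    then have "(\<Sum>s=Suc 0..l. real (l choose s) * (2 ^ s * g s)) \<le> M * (\<Sum>s=Suc 0..l. x ^ s)"
      unfolding sum_distrib_left by (intro sum_mono)
    also have "\<dots> \<le> M * (x ^ Suc 0 / (1 - x))"
      using M x x' by (intro mult_left_mono sum_power_atLeastAtMost_le) auto
    also have "\<dots> \<le> M * (3 / 22)"
      using M x x' by (intro mult_left_mono) (auto simp: field_simps)
    finally show ?thesis .
  qed
  finally have "real (card {W \<in> Pow E. \<forall>i\<in>I. \<not> S i \<subseteq> W}) * real (card I)
       \<le> 2 ^ card E * (M / 10 + M * (3 / 22))"
    by simp
  moreover have "real (card {W \<in> Pow E. \<forall>i\<in>I. \<not> S i \<subseteq> W}) * (9 / 10 * M)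
      \<le> real (card {W \<in> Pow E. \<forall>i\<in>I. \<not> S i \<subseteq> W}) * real (card I)"
    using M by (intro mult_left_mono) auto
  ultimately have "M * (real (card {W \<in> Pow E. \<forall>i\<in>I. \<not> S i \<subseteq> W}) * (9 / 10)) \<le> M * (2 ^ card E * (1 / 10 + 3 / 22))"
    by (simp add: algebra_simps)
  then have "real (card {W \<in> Pow E. \<forall>i\<in>I. \<not> S i \<subseteq> W}) * (9 / 10) \<le> 2 ^ card E * (1 / 10 + 3 / 22)"
    using M by simp
  moreover have half: "2 * x < P" if "x * (9 / 10) \<le> P * (1 / 10 + 3 / 22)" "0 < P" for x P :: real
    using that by simp
  ultimately have "2 * real (card {W \<in> Pow E. \<forall>i\<in>I. \<not> S i \<subseteq> W}) < 2 ^ card E"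
    by (intro half) simp_all
  then have "real (2 * card {W \<in> Pow E. \<forall>i\<in>I. \<not> S i \<subseteq> W}) < real (2 ^ card E)"
    by simp
  then show ?thesis
    using of_nat_less_iff by blast
qed

text \<open>A uniform \<open>W\<close> and its complement have the same distribution. Two failure
  probabilities below one half leave a \<open>W\<close> that contains some \<open>S i\<close> while
  \<open>E - W\<close> contains some \<open>R j\<close>.\<close>

lemma disjoint_members:
  assumes finE: "finite E"
    and A: "2 * card {W \<in> Pow E. \<forall>i\<in>I. \<not> S i \<subseteq> W} < 2 ^ card E"
    and B: "2 * card {W \<in> Pow E. \<forall>j\<in>J. \<not> R j \<subseteq> W} < 2 ^ card E"
  shows "\<exists>i\<in>I. \<exists>j\<in>J. S i \<inter> R j = {}"
proof (rule ccontr)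
  assume contra: "\<not> ?thesis"
  let ?A = "{W \<in> Pow E. \<forall>i\<in>I. \<not> S i \<subseteq> W}" and ?B = "{W \<in> Pow E. \<forall>j\<in>J. \<not> R j \<subseteq> W}"
  have "Pow E \<subseteq> ?A \<union> (\<lambda>W. E - W) ` ?B"
  proof
    fix W assume W: "W \<in> Pow E"
    show "W \<in> ?A \<union> (\<lambda>W. E - W) ` ?B"
    proof (cases "\<exists>i\<in>I. S i \<subseteq> W")
      case True
      then have "E - W \<in> ?B"
        using contra by blast
      moreover have "W = E - (E - W)"
        using W by auto
      ultimately show ?thesis
        by blast
    qed (use W in auto)
  qed
  then have "card (Pow E) \<le> card (?A \<union> (\<lambda>W. E - W) ` ?B)"
    using finE by (intro card_mono) auto
  also have "\<dots> \<le> card ?A + card ((\<lambda>W. E - W) ` ?B)"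
    by (rule card_Un_le)
  also have "\<dots> \<le> card ?A + card ?B"
    using finE by (intro add_left_mono card_image_le) auto
  finally show False
    using A B finE by (simp add: card_Pow)
qed

section \<open>Counting permutations\<close>

lemma mem_perm_graph: "(i, a) \<in> perm_graph n p \<longleftrightarrow> i \<in> {1..n} \<and> a = p i"
  unfolding perm_graph_def by auto

lemma Sigma_permsE:
  assumes "F \<in> Sigma_perms n"
  obtains p where "p permutes {1..n}" "F = perm_graph n p"
  using assms unfolding Sigma_perms_def by auto

lemma perm_graph_eq_image: "perm_graph n p = (\<lambda>i. (i, p i)) ` {1..n}"
  unfolding perm_graph_def by auto

lemma Sigma_perms_props:
  assumes "F \<in> Sigma_perms n"
  shows Sigma_perms_subset: "F \<subseteq> {1..n} \<times> {1..n}"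
    and finite_Sigma_perms_member: "finite F"
    and card_Sigma_perms_member: "card F = n"
    and inj_on_fst_Sigma_perms: "inj_on fst F"
    and inj_on_snd_Sigma_perms: "inj_on snd F"
proof -
  obtain p where p: "p permutes {1..n}" "F = perm_graph n p"
    using assms by (rule Sigma_permsE)
  show "F \<subseteq> {1..n} \<times> {1..n}"
    using permutes_image[OF p(1)] unfolding p(2) perm_graph_def by blast
  show "finite F" "card F = n"
    unfolding p(2) perm_graph_eq_image by (auto simp: card_image inj_on_def)
  show "inj_on fst F" "inj_on snd F"
    unfolding p(2) perm_graph_def
    by (auto simp: inj_on_def inj_eq[OF permutes_inj[OF p(1)]])
qed

lemma inj_on_perm_graph: "inj_on (perm_graph n) {p. p permutes {1..n}}"
proof (intro inj_onI ext)
  fix p q i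
  assume pq: "p \<in> {p. p permutes {1..n}}" "q \<in> {p. p permutes {1..n}}" "perm_graph n p = perm_graph n q"
  show "p i = q i"
  proof (cases "i \<in> {1..n}")
    case True
    then show ?thesis
      using pq(3) mem_perm_graph by blast
  next
    case False
    then show ?thesis
      using pq(1,2) by (auto simp: permutes_def)
  qed
qed

lemma Sigma_perms_eq_image: "Sigma_perms n = perm_graph n ` {p. p permutes {1..n}}"
  unfolding Sigma_perms_def by auto

lemma finite_Sigma_perms [simp]: "finite (Sigma_perms n)"
  unfolding Sigma_perms_eq_image by (simp add: finite_permutations)

lemma partial_permutation_iff:
  "partial_permutation n X \<longleftrightarrow> X \<subseteq> {1..n} \<times> {1..n} \<and> inj_on fst X \<and> inj_on snd X"
proof
  assume "partial_permutation n X"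
  then obtain F where "F \<in> Sigma_perms n" "X \<subseteq> F"
    unfolding partial_permutation_def by auto
  then show "X \<subseteq> {1..n} \<times> {1..n} \<and> inj_on fst X \<and> inj_on snd X"
    using Sigma_perms_props[of F n] inj_on_subset by blast
next
  assume X: "X \<subseteq> {1..n} \<times> {1..n} \<and> inj_on fst X \<and> inj_on snd X"
  let ?D = "fst ` X" and ?R = "snd ` X" and ?N = "{1..n}"
  define f where "f = snd \<circ> inv_into X fst"
  have sub: "?D \<subseteq> ?N" "?R \<subseteq> ?N"
    using X by auto
  have f: "bij_betw f ?D ?R"
    unfolding f_def using X
    by (intro bij_betw_trans[of _ _ X] bij_betw_inv_into inj_on_imp_bij_betw) auto
  then have "card ?D = card ?R"
    by (rule bij_betw_same_card)
  then have "card (?N - ?D) = card (?N - ?R)"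
    using sub by (simp add: card_Diff_subset finite_subset)
  then obtain g where g: "bij_betw g (?N - ?D) (?N - ?R)"
    using finite_same_card_bij[of "?N - ?D" "?N - ?R"] by auto
  define p where "p i = (if i \<in> ?D then f i else if i \<in> ?N then g i else i)" for i
  have "bij_betw p ?D ?R"
    using f by (rule bij_betw_cong[THEN iffD1, rotated]) (auto simp: p_def)
  moreover have "bij_betw p (?N - ?D) (?N - ?R)"
    using g by (rule bij_betw_cong[THEN iffD1, rotated]) (auto simp: p_def)
  ultimately have "bij_betw p (?D \<union> (?N - ?D)) (?R \<union> (?N - ?R))"
    by (rule bij_betw_combine) auto
  moreover have "?D \<union> (?N - ?D) = ?N" "?R \<union> (?N - ?R) = ?N"
    using sub by auto
  ultimately have "p permutes ?N"
    using sub(1) by (intro bij_imp_permutes) (auto simp: p_def)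
  moreover have "X \<subseteq> perm_graph n p"
  proof
    fix x assume x: "x \<in> X"
    then have "inv_into X fst (fst x) = x"
      using X by (simp add: inv_into_f_f)
    then have "p (fst x) = snd x"
      using x unfolding p_def f_def by auto
    then show "x \<in> perm_graph n p"
      using x X by (cases x) (auto simp: mem_perm_graph)
  qed
  ultimately show "partial_permutation n X"
    unfolding partial_permutation_def Sigma_perms_def by blast
qed

lemma partial_permutation_subset:
  "partial_permutation n X \<Longrightarrow> Y \<subseteq> X \<Longrightarrow> partial_permutation n Y"
  unfolding partial_permutation_def by blast

lemma partial_permutation_finite: "partial_permutation n X \<Longrightarrow> finite X"
  unfolding partial_permutation_def using finite_Sigma_perms_member finite_subset by blast

lemma partial_permutation_card_le: "partial_permutation n X \<Longrightarrow> card X \<le> n"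
  unfolding partial_permutation_def
  using finite_Sigma_perms_member card_Sigma_perms_member card_mono by metis

lemma partial_permutation_exists:
  assumes "k \<le> n"
  shows "\<exists>X. partial_permutation n X \<and> card X = k"
proof -
  have F: "perm_graph n id \<in> Sigma_perms n"
    unfolding Sigma_perms_def using permutes_id by blast
  then obtain X where "X \<subseteq> perm_graph n id" "card X = k"
    using obtain_subset_with_card_n[of k "perm_graph n id"] card_Sigma_perms_member[OF F] assms by metis
  then show ?thesis
    using F unfolding partial_permutation_def by blast
qed

text \<open>Composing with the inverse of one permutation \<open>r\<close> through \<open>S\<close>
  turns "contains \<open>S\<close>" into "fixes the rows of \<open>S\<close> pointwise".\<close>

lemma card_supersets:
  assumes "partial_permutation n S"
  shows "card {F \<in> Sigma_perms n. S \<subseteq> F} = fact (n - card S)"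
proof -
  obtain F0 where "F0 \<in> Sigma_perms n" "S \<subseteq> F0"
    using assms unfolding partial_permutation_def by auto
  then obtain r where r: "r permutes {1..n}" "S \<subseteq> perm_graph n r"
    by (metis Sigma_permsE)
  define D where "D = fst ` S"
  have "inj_on fst S" "S \<subseteq> {1..n} \<times> {1..n}"
    using assms partial_permutation_iff by auto
  then have D: "card D = card S" "D \<subseteq> {1..n}"
    unfolding D_def by (auto simp: card_image)
  have S: "S = (\<lambda>i. (i, r i)) ` D"
  proof -
    have "x = (fst x, r (fst x))" if "x \<in> S" for x
      using r(2) that mem_perm_graph[of "fst x" "snd x" n r] by (metis prod.collapse subset_iff)
    then show ?thesis
      unfolding D_def image_image by (metis (no_types, lifting) image_cong image_ident)
  qed
  have S_iff: "S \<subseteq> perm_graph n p \<longleftrightarrow> (\<forall>i\<in>D. p i = r i)" for p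
    using D(2) unfolding S by (auto simp: mem_perm_graph)
  have "{F \<in> Sigma_perms n. S \<subseteq> F} = perm_graph n ` (\<lambda>q. r \<circ> q) ` {q. q permutes {1..n} - D}" (is "?L = ?R")
  proof
    show "?R \<subseteq> ?L"
    proof clarify
      fix q assume q: "q permutes {1..n} - D"
      then have "r \<circ> q permutes {1..n}"
        using permutes_compose[OF permutes_subset[OF q] r(1)] by auto
      moreover have "(r \<circ> q) i = r i" if "i \<in> D" for i
        using permutes_not_in[OF q, of i] that by simp
      ultimately show "perm_graph n (r \<circ> q) \<in> Sigma_perms n \<and> S \<subseteq> perm_graph n (r \<circ> q)"
        unfolding S_iff Sigma_perms_def by auto
    qed
    show "?L \<subseteq> ?R"
    proof clarify
      fix F assume F: "F \<in> Sigma_perms n" "S \<subseteq> F"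
      then obtain p where p: "p permutes {1..n}" "F = perm_graph n p"
        by (metis Sigma_permsE)
      define q where "q = inv r \<circ> p"
      have rq: "r \<circ> q = p"
        unfolding q_def using permutes_inv_o(1)[OF r(1)] by (simp add: o_assoc)
      have "q permutes {1..n}"
        unfolding q_def using permutes_compose[OF p(1) permutes_inv[OF r(1)]] .
      moreover have "q i = i" if "i \<in> D" for i
        using F(2) that permutes_inverses(2)[OF r(1)] unfolding p(2) S_iff q_def by simp
      ultimately have "q permutes {1..n} - D"
        by (intro permutes_superset[of q "{1..n}" "{1..n} - D"]) simp_all
      then show "F \<in> ?R"
        using rq p(2) by blast
    qed
  qed
  moreover have "inj_on (\<lambda>q. perm_graph n (r \<circ> q)) {q. q permutes {1..n} - D}"
  proof (rule inj_onI)
    fix q q' assume q: "q \<in> {q. q permutes {1..n} - D}" "q' \<in> {q. q permutes {1..n} - D}"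
      "perm_graph n (r \<circ> q) = perm_graph n (r \<circ> q')"
    then have "r \<circ> q permutes {1..n}" "r \<circ> q' permutes {1..n}"
      using permutes_compose[OF permutes_subset r(1)] by (metis Diff_subset mem_Collect_eq)+
    then have "r \<circ> q = r \<circ> q'"
      using inj_on_perm_graph[of n] q(3) by (simp add: inj_on_def)
    then show "q = q'"
      using permutes_inj[OF r(1)] by (simp add: fun_eq_iff inj_eq)
  qed
  moreover have "card {q. q permutes {1..n} - D} = fact (n - card S)"
    using D by (intro card_permutations) (auto simp: card_Diff_subset finite_subset)
  ultimately show ?thesis
    by (simp add: image_image card_image)
qed

lemma card_supersets_le: "card {F \<in> Sigma_perms n. S \<subseteq> F} \<le> fact (n - card S)"
proof (cases "partial_permutation n S")
  case False
  then have "{F \<in> Sigma_perms n. S \<subseteq> F} = {}"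
    unfolding partial_permutation_def by auto
  then show ?thesis
    by (metis card.empty zero_le)
qed (simp add: card_supersets)

section \<open>Kernels\<close>

definition containing :: "'a set set \<Rightarrow> 'a set \<Rightarrow> 'a set set" where
  "containing \<G> T = {F \<in> \<G>. T \<subseteq> F}"

text \<open>Cross-multiplied spreadness: enlarging \<open>T\<close> by \<open>U\<close> raises the
  density of \<G> among the permutations through the set by a factor of at most \<kappa>^|U|. The
  nonemptiness clause rules out sets contained in no member, for which the inequality reads 0 <=
  0.\<close>

definition kernel :: "nat \<Rightarrow> real \<Rightarrow> (nat \<times> nat) set set \<Rightarrow> (nat \<times> nat) set \<Rightarrow> bool" where
  "kernel n \<kappa> \<G> T \<longleftrightarrow> containing \<G> T \<noteq> {} \<and>
     (\<forall>U. finite U \<and> U \<inter> T = {} \<longrightarrow>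
        real (card (containing \<G> (T \<union> U))) * fact (n - card T)
          \<le> \<kappa> ^ card U * fact (n - card T - card U) * real (card (containing \<G> T)))"

lemma card_containing_le:
  assumes "\<G> \<subseteq> Sigma_perms n"
  shows "card (containing \<G> T) \<le> fact (n - card T)"
proof -
  have "card (containing \<G> T) \<le> card {F \<in> Sigma_perms n. T \<subseteq> F}"
    unfolding containing_def using assms by (intro card_mono) auto
  also have "\<dots> \<le> fact (n - card T)"
    by (rule card_supersets_le)
  finally show ?thesis .
qed

text \<open>A maximizer of the discounted density \<open>v\<close>. Comparison with larger sets
  gives spreadness; comparison with the empty set gives |\<G>|/n! = v({}) <= v(T) <=
  \<kappa>^(-|T|), as no density exceeds 1, so a large kernel means a small family.\<close>

lemma kernel_exists:
  assumes G: "\<G> \<subseteq> Sigma_perms n" "\<G> \<noteq> {}" and \<kappa>: "0 < \<kappa>"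
  shows "\<exists>T. kernel n \<kappa> \<G> T \<and> real (card \<G>) * \<kappa> ^ card T \<le> fact n"
proof -
  define v where "v T = real (card (containing \<G> T)) / (\<kappa> ^ card T * fact (n - card T))" for T
  let ?P = "Pow ({1..n} \<times> {1..n})"
  have "Max (v ` ?P) \<in> v ` ?P"
    by (intro Max_in) auto
  then obtain T where T0: "T \<in> ?P" "Max (v ` ?P) = v T"
    by (rule imageE)
  have T: "T \<in> ?P" "\<And>T'. T' \<in> ?P \<Longrightarrow> v T' \<le> v T"
    unfolding T0(2)[symmetric] by (rule T0(1)) (intro Max_ge finite_imageI imageI, auto)
  have finG: "finite \<G>"
    using G(1) finite_subset by fastforce
  have "v {} = real (card \<G>) / fact n"
    unfolding v_def containing_def by simp
  then have v0: "real (card \<G>) / fact n \<le> v T"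
    using T(2)[of "{}"] by simp
  moreover have "0 < real (card \<G>) / fact n"
    using G(2) finG by (simp add: card_gt_0_iff)
  ultimately have "0 < v T"
    by linarith
  then have ne: "containing \<G> T \<noteq> {}"
    unfolding v_def by auto
  have "v T \<le> 1 / \<kappa> ^ card T"
  proof -
    have "real (card (containing \<G> T)) \<le> fact (n - card T)"
      using card_containing_le[OF G(1), of T] by (metis of_nat_fact of_nat_le_iff)
    then show ?thesis
      unfolding v_def using \<kappa> by (simp add: field_simps)
  qed
  with v0 have "real (card \<G>) / fact n \<le> 1 / \<kappa> ^ card T"
    by linarith
  then have bound: "real (card \<G>) * \<kappa> ^ card T \<le> fact n"
    using \<kappa> by (simp add: field_simps)
  have "real (card (containing \<G> (T \<union> U))) * fact (n - card T)
          \<le> \<kappa> ^ card U * fact (n - card T - card U) * real (card (containing \<G> T))"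
    if U: "finite U" "U \<inter> T = {}" for U
  proof (cases "T \<union> U \<in> ?P")
    case True
    have "finite T"
      using T(1) finite_subset by auto
    then have "card (T \<union> U) = card T + card U"
      using U by (simp add: card_Un_disjoint Int_commute)
    then have "real (card (containing \<G> (T \<union> U))) / (\<kappa> ^ card T * \<kappa> ^ card U * fact (n - card T - card U))
        \<le> real (card (containing \<G> T)) / (\<kappa> ^ card T * fact (n - card T))"
      using T(2)[OF True] unfolding v_def by (simp add: power_add)
    moreover have "a * f \<le> k' * f' * b" if "a / (k * k' * f') \<le> b / (k * f)" "0 < k" "0 < k'" "0 < f" "0 < f'"
      for a b k k' f f' :: real
      using that by (simp add: field_simps)
    ultimately show ?thesis
      using \<kappa> by simp
  next
    case False
    have "containing \<G> (T \<union> U) = {}"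
    proof (rule ccontr)
      assume "containing \<G> (T \<union> U) \<noteq> {}"
      then obtain F where "F \<in> Sigma_perms n" "T \<union> U \<subseteq> F"
        using G(1) unfolding containing_def by auto
      then show False
        using Sigma_perms_subset[of F n] False by blast
    qed
    then show ?thesis
      using \<kappa> by simp
  qed
  then show ?thesis
    using ne bound unfolding kernel_def by blast
qed

text \<open>\<open>T'\<close> stands for the other kernel, which the members in \<open>I\<close>
  must avoid outside \<open>T\<close>. By spreadness each cell of \<open>T' - T\<close> lies in at
  most a \<kappa>/m fraction of the members through \<open>T\<close>, where m = n - |T|; the at most
  \<open>q\<close> such cells remove at most a tenth of them, whence the 9/10.\<close>

lemma kernel_uncovered_lt_half:
  assumes G: "\<G> \<subseteq> Sigma_perms n" and ker: "kernel n \<kappa> \<G> T"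
    and T': "finite T'" "card T \<le> q" "card T' \<le> q"
    and \<kappa>: "3 \<le> \<kappa>" "200 * \<kappa>\<^sup>2 \<le> real (n - q)" "10 * \<kappa> * real q \<le> real (n - q)"
    and E: "E = {1..n} \<times> {1..n} - T - T'"
    and I: "I = {F \<in> \<G>. T \<subseteq> F \<and> F \<inter> T' \<subseteq> T}"
  shows "2 * card {W \<in> Pow E. \<forall>F\<in>I. \<not> F - T \<subseteq> W} < 2 ^ card E"
proof (rule uncovered_lt_half[where m = "n - card T" and M = "real (card (containing \<G> T))" and \<kappa> = \<kappa>])
  let ?m = "n - card T" and ?M = "real (card (containing \<G> T))"
  have finG: "finite \<G>"
    using G finite_subset by fastforce
  then have fin_containing: "finite (containing \<G> Y)" for Y
    unfolding containing_def by simp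
  show "finite E"
    unfolding E by simp
  show "finite I"
    unfolding I using finG by simp
  show "F - T \<subseteq> E" if "F \<in> I" for F
    using that Sigma_perms_subset[of F n] G unfolding I E by blast
  show "card (F - T) \<le> ?m" if "F \<in> I" for F
  proof -
    have "F \<in> Sigma_perms n" "T \<subseteq> F"
      using that G unfolding I by auto
    then show ?thesis
      using card_Sigma_perms_member finite_Sigma_perms_member finite_subset
      by (metis card_Diff_subset order_refl)
  qed
  have spread: "real (card (containing \<G> (T \<union> U))) \<le> ?M * (\<kappa> ^ card U * (fact (?m - card U) / fact ?m))"
    if "finite U" "U \<inter> T = {}" for U
  proof -
    have "real (card (containing \<G> (T \<union> U))) * fact ?m \<le> \<kappa> ^ card U * fact (?m - card U) * ?M"
      using ker that unfolding kernel_def by blast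
    then show ?thesis
      by (simp add: field_simps)
  qed
  show "real (card {F \<in> I. U \<subseteq> F - T}) \<le> ?M * (\<kappa> ^ card U * (fact (?m - card U) / fact ?m))"
    if "U \<subseteq> E" for U
  proof -
    have "card {F \<in> I. U \<subseteq> F - T} \<le> card (containing \<G> (T \<union> U))"
      using fin_containing[of "T \<union> U"] unfolding I containing_def by (intro card_mono) auto
    moreover have "finite U" "U \<inter> T = {}"
      using that finite_subset[of U E] unfolding E by auto
    ultimately show ?thesis
      using spread[of U] by simp
  qed
  show M: "0 < ?M"
    using ker fin_containing[of T] unfolding kernel_def by (simp add: card_gt_0_iff)
  show "3 \<le> \<kappa>"
    by fact
  have mq: "real (n - q) \<le> real ?m"
    using T' by simp
  then show "200 * \<kappa>\<^sup>2 \<le> real ?m"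
    using \<kappa> by linarith
  have "0 < 200 * \<kappa>\<^sup>2"
    using \<kappa> by simp
  then have m: "0 < real ?m"
    using mq \<kappa>(2) by linarith
  have "containing \<G> T \<subseteq> I \<union> (\<Union>x\<in>T' - T. containing \<G> (T \<union> {x}))"
    unfolding I containing_def by auto
  then have "card (containing \<G> T) \<le> card (I \<union> (\<Union>x\<in>T' - T. containing \<G> (T \<union> {x})))"
    using T' fin_containing \<open>finite I\<close> by (intro card_mono) auto
  also have "\<dots> \<le> card I + card (\<Union>x\<in>T' - T. containing \<G> (T \<union> {x}))"
    by (rule card_Un_le)
  also have "card (\<Union>x\<in>T' - T. containing \<G> (T \<union> {x})) \<le> (\<Sum>x\<in>T' - T. card (containing \<G> (T \<union> {x})))"
    using T' by (intro card_UN_le) auto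
  finally have "?M \<le> real (card I) + (\<Sum>x\<in>T' - T. real (card (containing \<G> (T \<union> {x}))))"
    by (simp flip: of_nat_sum of_nat_add)
  also have "(\<Sum>x\<in>T' - T. real (card (containing \<G> (T \<union> {x})))) \<le> (\<Sum>x\<in>T' - T. ?M * (\<kappa> / real ?m))"
  proof (rule sum_mono)
    fix x assume "x \<in> T' - T"
    then have "real (card (containing \<G> (T \<union> {x}))) \<le> ?M * (\<kappa> ^ card {x} * (fact (?m - card {x}) / fact ?m))"
      by (intro spread) auto
    moreover have "(fact ?m :: real) = real ?m * fact (?m - 1)"
      using m by (intro fact_reduce) simp
    ultimately show "real (card (containing \<G> (T \<union> {x}))) \<le> ?M * (\<kappa> / real ?m)"
      by simp
  qed
  also have "(\<Sum>x\<in>T' - T. ?M * (\<kappa> / real ?m)) \<le> real q * (?M * (\<kappa> / real ?m))"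
  proof -
    have "card (T' - T) \<le> q"
      using T' by (meson card_mono Diff_subset order_trans)
    then show ?thesis
      unfolding sum_constant using \<kappa> by (intro mult_right_mono) auto
  qed
  also have "\<dots> = ?M * (\<kappa> * real q / real ?m)"
    by simp
  also have "\<dots> \<le> ?M * (1 / 10)"
    using m \<kappa>(3) mq by (intro mult_left_mono) (auto simp: field_simps)
  finally show "9 / 10 * ?M \<le> real (card I)"
    by simp
qed

text \<open>Two members disjoint outside their kernels are found in complementary random halves.
  Since each also avoids the other kernel outside its own, their whole intersection lies in
  \<open>T\<^sub>1 \<inter> T\<^sub>2\<close>.\<close>

lemma kernels_intersect:
  assumes \<F>: "\<F> \<subseteq> Sigma_perms n" "t_intersecting t \<F>"
    and G: "\<G>\<^sub>1 \<subseteq> \<F>" "\<G>\<^sub>2 \<subseteq> \<F>"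
    and ker: "kernel n \<kappa> \<G>\<^sub>1 T\<^sub>1" "kernel n \<kappa> \<G>\<^sub>2 T\<^sub>2"
    and q: "card T\<^sub>1 \<le> q" "card T\<^sub>2 \<le> q"
    and \<kappa>: "3 \<le> \<kappa>" "200 * \<kappa>\<^sup>2 \<le> real (n - q)" "10 * \<kappa> * real q \<le> real (n - q)"
  shows "t \<le> card (T\<^sub>1 \<inter> T\<^sub>2)"
proof -
  have sub: "\<G>\<^sub>1 \<subseteq> Sigma_perms n" "\<G>\<^sub>2 \<subseteq> Sigma_perms n"
    using \<F> G by auto
  have fin: "finite T" if "kernel n \<kappa> \<G> T" "\<G> \<subseteq> Sigma_perms n" for \<G> T
  proof -
    obtain F where "F \<in> Sigma_perms n" "T \<subseteq> F"
      using \<open>kernel n \<kappa> \<G> T\<close> \<open>\<G> \<subseteq> Sigma_perms n\<close> unfolding kernel_def containing_def by auto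
    then show ?thesis
      using finite_Sigma_perms_member finite_subset by blast
  qed
  let ?E = "{1..n} \<times> {1..n} - T\<^sub>1 - T\<^sub>2"
  let ?I = "{F \<in> \<G>\<^sub>1. T\<^sub>1 \<subseteq> F \<and> F \<inter> T\<^sub>2 \<subseteq> T\<^sub>1}" and ?J = "{F \<in> \<G>\<^sub>2. T\<^sub>2 \<subseteq> F \<and> F \<inter> T\<^sub>1 \<subseteq> T\<^sub>2}"
  have "\<exists>F\<in>?I. \<exists>F'\<in>?J. (F - T\<^sub>1) \<inter> (F' - T\<^sub>2) = {}"
  proof (rule disjoint_members)
    show "finite ?E"
      by simp
    show "2 * card {W \<in> Pow ?E. \<forall>F\<in>?I. \<not> F - T\<^sub>1 \<subseteq> W} < 2 ^ card ?E"
      by (rule kernel_uncovered_lt_half[OF sub(1) ker(1) fin[OF ker(2) sub(2)] q \<kappa>]) auto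
    show "2 * card {W \<in> Pow ?E. \<forall>F\<in>?J. \<not> F - T\<^sub>2 \<subseteq> W} < 2 ^ card ?E"
      by (rule kernel_uncovered_lt_half[OF sub(2) ker(2) fin[OF ker(1) sub(1)] q(2,1) \<kappa>]) auto
  qed
  then obtain F F' where F: "F \<in> ?I" "F' \<in> ?J" "(F - T\<^sub>1) \<inter> (F' - T\<^sub>2) = {}"
    by blast
  then have "F \<inter> F' \<subseteq> T\<^sub>1 \<inter> T\<^sub>2"
    by blast
  then have "card (F \<inter> F') \<le> card (T\<^sub>1 \<inter> T\<^sub>2)"
    using fin[OF ker(1) sub(1)] by (intro card_mono) auto
  moreover have "t \<le> card (F \<inter> F')"
    using \<F>(2) F G unfolding t_intersecting_def by blast
  ultimately show ?thesis
    by linarith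
qed

lemma fact_le_power_mult_fact: "k \<le> n \<Longrightarrow> (fact n :: nat) \<le> n ^ k * fact (n - k)"
  using fact_div_fact_le_pow[of k n] fact_dvd[of "n - k" n]
  by (metis diff_le_self dvd_div_mult_self mult_le_mono1)

text \<open>\<S> collects the small kernels of all subfamilies of \<F>. The members containing none
  of them form a subfamily that has a kernel of its own; this kernel must be large, so the subfamily
  is small.\<close>

lemma kernel_family:
  assumes t: "1 \<le> t" and n: "6 * (t + 4) ^ 4 \<le> n"
    and \<F>: "\<F> \<subseteq> Sigma_perms n" "t_intersecting t \<F>"
  obtains \<S> where "\<And>S. S \<in> \<S> \<Longrightarrow> partial_permutation n S" "\<And>S. S \<in> \<S> \<Longrightarrow> card S \<le> 6 * t + 11"
    "\<And>S S'. S \<in> \<S> \<Longrightarrow> S' \<in> \<S> \<Longrightarrow> t \<le> card (S \<inter> S')"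
    "card {F \<in> \<F>. \<forall>S\<in>\<S>. \<not> S \<subseteq> F} \<le> fact (n - t - 2)"
proof -
  define \<kappa> where "\<kappa> = root 6 (real n)"
  define q where "q = 6 * t + 11"
  define a where "a = real t + 4"
  have a: "5 \<le> a" "6 * a ^ 4 \<le> real n"
    using t n of_nat_mono[OF n, where 'a = real] unfolding a_def by auto
  have n25: "150 * a\<^sup>2 \<le> real n"
  proof -
    have "5\<^sup>2 * a\<^sup>2 \<le> a\<^sup>2 * a\<^sup>2"
      using a by (intro mult_right_mono power_mono) auto
    then show ?thesis
      using a(2) by (simp add: power4_eq_xxxx power2_eq_square mult.assoc)
  qed
  have "5 * a \<le> a\<^sup>2"
    unfolding power2_eq_square using a by (intro mult_right_mono) auto
  with n25 have n750: "750 * a \<le> real n"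
    by linarith
  have \<kappa>6: "\<kappa> ^ 6 = real n" and \<kappa>0: "0 \<le> \<kappa>"
    unfolding \<kappa>_def by simp_all
  \<comment> \<open>3.9^6 is about 3519, below 750 * 5 <= n. The fourth power, about 231.3, gives
    231\<kappa>^2 <= n, which leaves slack over the required 200 when \<open>q\<close> cells are
    taken away.\<close>
  have "(39/10) ^ 6 \<le> \<kappa> ^ 6"
    unfolding \<kappa>6 using n750 a(1) by (simp add: power_divide)
  then have \<kappa>: "39/10 \<le> \<kappa>"
    using \<kappa>0 by (rule power_le_imp_le_base[of _ 5, simplified])
  have \<kappa>2: "231 * \<kappa>\<^sup>2 \<le> real n"
  proof -
    have "231 * \<kappa>\<^sup>2 \<le> (39/10) ^ 4 * \<kappa>\<^sup>2"
      by (intro mult_right_mono) (auto simp: power_divide)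
    also have "\<dots> \<le> \<kappa> ^ 4 * \<kappa>\<^sup>2"
      using \<kappa> by (intro mult_right_mono power_mono) auto
    finally show ?thesis
      using \<kappa>6 by (simp flip: power_add)
  qed
  have q: "real q \<le> 6 * a" "100 * real q \<le> real n" "q \<le> n"
    using n750 a unfolding q_def a_def by auto
  then have nq: "real (n - q) = real n - real q"
    by (simp add: of_nat_diff)
  have cond: "3 \<le> \<kappa>" "200 * \<kappa>\<^sup>2 \<le> real (n - q)" "10 * \<kappa> * real q \<le> real (n - q)"
  proof -
    show "3 \<le> \<kappa>"
      using \<kappa> by simp
    show "200 * \<kappa>\<^sup>2 \<le> real (n - q)"
      using \<kappa>2 q nq by linarith
    have "real q ^ 2 \<le> (6 * a)\<^sup>2"
      using q by (intro power_mono) auto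
    have q2: "real q ^ 2 \<le> real n"
    proof -
      have "(6 * a)\<^sup>2 = 36 * a\<^sup>2"
        by (simp add: power_mult_distrib)
      then show ?thesis
        using n25 \<open>(real q)\<^sup>2 \<le> (6 * a)\<^sup>2\<close> zero_le_power2[of a] by linarith
    qed
    have "(10 * \<kappa> * real q)\<^sup>2 = 100 * (\<kappa>\<^sup>2 * real q ^ 2)"
      by (simp add: power_mult_distrib)
    also have "\<dots> \<le> 100 * (real n / 231 * real n)"
      using \<kappa>2 q2 by (intro mult_left_mono mult_mono) auto
    also have "\<dots> \<le> (real n * (9 / 10))\<^sup>2"
      by (simp add: power2_eq_square)
    finally have "10 * \<kappa> * real q \<le> real n * (9 / 10)"
      by (rule power2_le_imp_le) simp
    then show "10 * \<kappa> * real q \<le> real (n - q)"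
      using q nq by linarith
  qed
  define \<S> where "\<S> = {S. card S \<le> q \<and> (\<exists>\<G>\<subseteq>\<F>. kernel n \<kappa> \<G> S)}"
  define R where "R = {F \<in> \<F>. \<forall>S\<in>\<S>. \<not> S \<subseteq> F}"
  show ?thesis
  proof (rule that[of \<S>])
    show "partial_permutation n S" if "S \<in> \<S>" for S
      using that \<F>(1) unfolding \<S>_def kernel_def containing_def partial_permutation_def by blast
    show "card S \<le> 6 * t + 11" if "S \<in> \<S>" for S
      using that unfolding \<S>_def q_def by auto
    show "t \<le> card (S \<inter> S')" if S: "S \<in> \<S>" "S' \<in> \<S>" for S S'
    proof -
      obtain \<G> \<G>' where "\<G> \<subseteq> \<F>" "kernel n \<kappa> \<G> S" "\<G>' \<subseteq> \<F>" "kernel n \<kappa> \<G>' S'" "card S \<le> q" "card S' \<le> q"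
        using S unfolding \<S>_def by auto
      then show ?thesis
        using kernels_intersect[OF \<F> _ _ _ _ _ _ cond] by blast
    qed
    show "card {F \<in> \<F>. \<forall>S\<in>\<S>. \<not> S \<subseteq> F} \<le> fact (n - t - 2)"
    proof (cases "R = {}")
      case False
      have R: "R \<subseteq> \<F>" "R \<subseteq> Sigma_perms n"
        using \<F>(1) unfolding R_def by auto
      obtain T where T: "kernel n \<kappa> R T" "real (card R) * \<kappa> ^ card T \<le> fact n"
        using kernel_exists[OF R(2) False, of \<kappa>] \<kappa> by auto
      \<comment> \<open>Being a kernel of \<open>R\<close>, \<open>T\<close> lies in a member of
        \<open>R\<close>, and such members contain no set from \<S>.\<close>
      have "T \<notin> \<S>"
        using T(1) unfolding kernel_def containing_def R_def by blast
      then have "6 * (t + 2) \<le> card T"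
        using T(1) R(1) unfolding \<S>_def q_def by auto
      then have "\<kappa> ^ (6 * (t + 2)) \<le> \<kappa> ^ card T"
        using \<kappa> by (intro power_increasing) auto
      then have "real n ^ (t + 2) \<le> \<kappa> ^ card T"
        unfolding power_mult \<kappa>6 .
      then have "real (card R) * real n ^ (t + 2) \<le> fact n"
        using T(2) by (meson mult_left_mono of_nat_0_le_iff order_trans)
      then have "real (card R * n ^ (t + 2)) \<le> real (fact n)"
        by simp
      then have "card R * n ^ (t + 2) \<le> fact n"
        using of_nat_le_iff by blast
      also have "\<dots> \<le> n ^ (t + 2) * fact (n - (t + 2))"
        using n750 a by (intro fact_le_power_mult_fact) (auto simp: a_def)
      finally have "n ^ (t + 2) * card R \<le> n ^ (t + 2) * fact (n - t - 2)"
        by (simp add: mult.commute)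
      moreover have "0 < n"
        using n750 a by (cases n) auto
      ultimately show ?thesis
        unfolding R_def by simp
    qed (simp add: R_def[symmetric])
  qed
qed

section \<open>Sets generated by an intersecting family\<close>

definition upset :: "nat \<Rightarrow> (nat \<times> nat) set set \<Rightarrow> (nat \<times> nat) set set" where
  "upset n \<D> = {F \<in> Sigma_perms n. \<exists>S\<in>\<D>. S \<subseteq> F}"

lemma finite_upset [simp]: "finite (upset n \<D>)"
  unfolding upset_def by simp

lemma card_upset_mono: "\<D> \<subseteq> \<D>' \<Longrightarrow> card (upset n \<D>) \<le> card (upset n \<D>')"
  by (rule card_mono) (auto simp: upset_def)

lemma card_upset_UN_le:
  assumes "finite V" "\<And>S. S \<in> \<D> \<Longrightarrow> \<exists>x\<in>V. S \<in> \<D>' x"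
  shows "card (upset n \<D>) \<le> (\<Sum>x\<in>V. card (upset n (\<D>' x)))"
proof -
  have "card (upset n \<D>) \<le> card (\<Union>x\<in>V. upset n (\<D>' x))"
    using assms by (intro card_mono) (auto simp: upset_def, metis)
  also have "\<dots> \<le> (\<Sum>x\<in>V. card (upset n (\<D>' x)))"
    by (rule card_UN_le[OF assms(1)])
  finally show ?thesis .
qed

lemma card_upset_above_le: "card (upset n {S \<in> \<D>. C \<subseteq> S}) \<le> fact (n - card C)"
proof -
  have "card (upset n {S \<in> \<D>. C \<subseteq> S}) \<le> card {F \<in> Sigma_perms n. C \<subseteq> F}"
    by (rule card_mono) (auto simp: upset_def)
  also have "\<dots> \<le> fact (n - card C)"
    by (rule card_supersets_le)
  finally show ?thesis .
qed

section \<open>Branching on covers\<close>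

text \<open>A search tree of depth \<open>r\<close>: every set of \<D> above \<open>C'\<close> uses
  one of at most \<open>q\<close> new cells from \<open>V\<close>, so at most \<open>q ^ r\<close>
  leaves arise, each a set of size |C| + r. An empty \<open>V\<close> closes a branch that no set of
  \<D> follows.\<close>

lemma card_upset_branch:
  assumes "finite C"
    and "\<And>C'. finite C' \<Longrightarrow> C \<subseteq> C' \<Longrightarrow> card C' < card C + r \<Longrightarrow>
      \<exists>V. finite V \<and> card V \<le> q \<and> V \<inter> C' = {} \<and> (\<forall>S\<in>\<D>. C' \<subseteq> S \<longrightarrow> S \<inter> V \<noteq> {})"
  shows "card (upset n {S \<in> \<D>. C \<subseteq> S}) \<le> q ^ r * fact (n - card C - r)"
  using assms
proof (induction r arbitrary: C)
  case 0
  then show ?case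
    by (simp add: card_upset_above_le)
next
  case (Suc r)
  obtain V where V: "finite V" "card V \<le> q" "V \<inter> C = {}" "\<And>S. S \<in> \<D> \<Longrightarrow> C \<subseteq> S \<Longrightarrow> S \<inter> V \<noteq> {}"
    using Suc.prems(2)[of C] Suc.prems(1) by auto
  have "card (upset n {S \<in> \<D>. C \<subseteq> S}) \<le> (\<Sum>x\<in>V. card (upset n {S \<in> \<D>. insert x C \<subseteq> S}))"
    using V(4) by (intro card_upset_UN_le[OF V(1)]) blast
  also have "\<dots> \<le> (\<Sum>x\<in>V. q ^ r * fact (n - card C - Suc r))"
  proof (rule sum_mono)
    fix x assume "x \<in> V"
    then have x: "card (insert x C) = Suc (card C)"
      using V(3) Suc.prems(1) by (subst card_insert_disjoint) auto
    have "card (upset n {S \<in> \<D>. insert x C \<subseteq> S}) \<le> q ^ r * fact (n - card (insert x C) - r)"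
      using Suc.prems x by (intro Suc.IH) auto
    then show "card (upset n {S \<in> \<D>. insert x C \<subseteq> S}) \<le> q ^ r * fact (n - card C - Suc r)"
      unfolding x by simp
  qed
  also have "\<dots> \<le> q * (q ^ r * fact (n - card C - Suc r))"
    using V(2) by simp
  finally show ?case
    by (simp add: mult.assoc)
qed

text \<open>Each \<open>S\<close> contains one of the \<open>t\<close>-subsets of the minimum cover
  \<open>C\<close>. From such a \<open>T\<close> the branching can go on for \<open>r\<close>
  levels: a set \<open>C'\<close> with fewer than \<open>t + r\<close> cells is no cover, so some
  \<open>S'\<close> meets it in fewer than \<open>t\<close> cells, and every \<open>S\<close> above
  \<open>C'\<close> must meet \<open>S'\<close> outside \<open>C'\<close>.\<close>

lemma card_upset_min_cover:
  assumes S: "\<And>S. S \<in> \<S> \<Longrightarrow> finite S" "\<And>S. S \<in> \<S> \<Longrightarrow> card S \<le> q"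
    "\<And>S S'. S \<in> \<S> \<Longrightarrow> S' \<in> \<S> \<Longrightarrow> t \<le> card (S \<inter> S')"
    and C: "finite C" "card C = t + r" "\<And>S. S \<in> \<S> \<Longrightarrow> t \<le> card (C \<inter> S)"
    and min: "\<And>C'. finite C' \<Longrightarrow> card C' < t + r \<Longrightarrow> \<exists>S\<in>\<S>. card (C' \<inter> S) < t"
  shows "card (upset n \<S>) \<le> ((t + r) choose t) * (q ^ r * fact (n - t - r))"
proof -
  let ?\<T> = "{T. T \<subseteq> C \<and> card T = t}"
  have "card (upset n \<S>) \<le> (\<Sum>T\<in>?\<T>. card (upset n {S \<in> \<S>. T \<subseteq> S}))"
  proof (rule card_upset_UN_le)
    show "finite ?\<T>"
      using C(1) by simp
    fix S assume "S \<in> \<S>"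
    then obtain T where "T \<subseteq> C \<inter> S" "card T = t"
      using C(3) obtain_subset_with_card_n by metis
    then show "\<exists>T\<in>?\<T>. S \<in> {S \<in> \<S>. T \<subseteq> S}"
      using \<open>S \<in> \<S>\<close> by auto
  qed
  also have "\<dots> \<le> (\<Sum>T\<in>?\<T>. q ^ r * fact (n - t - r))"
  proof (rule sum_mono)
    fix T assume T: "T \<in> ?\<T>"
    have "card (upset n {S \<in> \<S>. T \<subseteq> S}) \<le> q ^ r * fact (n - card T - r)"
    proof (rule card_upset_branch)
      show "finite T"
        using T C(1) finite_subset by auto
      fix C' assume C': "finite C'" "T \<subseteq> C'" "card C' < card T + r"
      then obtain S' where S': "S' \<in> \<S>" "card (C' \<inter> S') < t"
        using min[of C'] T by auto
      have "S \<inter> (S' - C') \<noteq> {}" if "S \<in> \<S>" "C' \<subseteq> S" for S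
      proof
        assume "S \<inter> (S' - C') = {}"
        then have "card (S \<inter> S') \<le> card (C' \<inter> S')"
          using C'(1) by (intro card_mono) auto
        then show False
          using S(3)[OF that(1) S'(1)] S'(2) by linarith
      qed
      moreover have "card (S' - C') \<le> q" "finite (S' - C')"
        using S(1,2)[OF S'(1)] by (auto intro: order_trans[OF card_mono])
      ultimately show "\<exists>V. finite V \<and> card V \<le> q \<and> V \<inter> C' = {} \<and> (\<forall>S\<in>\<S>. C' \<subseteq> S \<longrightarrow> S \<inter> V \<noteq> {})"
        by (intro exI[of _ "S' - C'"]) auto
    qed
    then show "card (upset n {S \<in> \<S>. T \<subseteq> S}) \<le> q ^ r * fact (n - t - r)"
      using T by simp
  qed
  also have "\<dots> = ((t + r) choose t) * (q ^ r * fact (n - t - r))"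
    using n_subsets[OF C(1), of t] C(2) by simp
  finally show ?thesis .
qed

text \<open>Raising \<open>r\<close> by one multiplies the binomial coefficient by at most
  \<open>q\<close> and the power by \<open>q\<close>, while the factorial loses the factor n-t-r,
  which is at least q^2.\<close>

lemma cover_bound_antimono:
  assumes "2 \<le> r" "t + r \<le> q" "q\<^sup>2 + q \<le> n"
  shows "((t + r) choose t) * (q ^ r * fact (n - t - r)) \<le> ((t + 2) choose t) * (q\<^sup>2 * fact (n - t - 2))"
  using assms(1,2)
proof (induction r rule: nat_induct_at_least)
  case (Suc r)
  have "(t + Suc r) choose t \<le> ((t + r) choose t) * Suc (t + r)"
  proof -
    have "((t + Suc r) choose t) * Suc r = ((t + r) choose t) * Suc (t + r)"
      using binomial_absorb_comp[of "Suc (t + r)" t] by (simp add: mult.commute)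
    then show ?thesis
      by (metis le_add1 mult.commute mult_Suc)
  qed
  also have "\<dots> \<le> ((t + r) choose t) * q"
    using Suc.prems by (intro mult_le_mono2) simp
  finally have "((t + Suc r) choose t) * q \<le> ((t + r) choose t) * (q * q)"
    using mult_le_mono1 by (simp add: mult.assoc[symmetric])
  also have "\<dots> \<le> ((t + r) choose t) * (n - t - r)"
    using Suc.prems assms(3) by (intro mult_le_mono2) (simp add: power2_eq_square)
  finally have *: "((t + Suc r) choose t) * q \<le> ((t + r) choose t) * (n - t - r)" .
  have "0 < n - t - r"
    using Suc.prems assms(3) by (simp add: power2_eq_square)
  then have f: "(fact (n - t - r) :: nat) = (n - t - r) * fact (n - t - Suc r)"
    using fact_reduce[of "n - t - r", where 'a = nat] by simp
  have "((t + Suc r) choose t) * (q ^ Suc r * fact (n - t - Suc r))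
      = (((t + Suc r) choose t) * q) * (q ^ r * fact (n - t - Suc r))"
    by simp
  also have "\<dots> \<le> (((t + r) choose t) * (n - t - r)) * (q ^ r * fact (n - t - Suc r))"
    using * by (rule mult_le_mono1)
  also have "\<dots> = ((t + r) choose t) * (q ^ r * fact (n - t - r))"
    unfolding f by (simp add: mult_ac)
  also have "\<dots> \<le> ((t + 2) choose t) * (q\<^sup>2 * fact (n - t - 2))"
    using Suc by simp
  finally show ?case .
qed simp

text \<open>
  Sets not containing \<open>Y\<close> miss exactly one cell of it. Two sets missing different cells share at
  most \<open>t - 1\<close> cells inside \<open>Y\<close>, so they also meet outside \<open>Y\<close>.
\<close>

lemma near_cover_dichotomy:
  fixes \<S> :: "(nat \<times> nat) set set"
  assumes S: "\<And>S. S \<in> \<S> \<Longrightarrow> partial_permutation n S" "\<And>S. S \<in> \<S> \<Longrightarrow> card S \<le> q"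
    "\<And>S S'. S \<in> \<S> \<Longrightarrow> S' \<in> \<S> \<Longrightarrow> t \<le> card (S \<inter> S')"
    and star: "\<And>T. card T = t \<Longrightarrow> \<exists>S\<in>\<S>. \<not> T \<subseteq> S"
    and Y: "finite Y" "card Y = t + 1" "\<And>S. S \<in> \<S> \<Longrightarrow> t \<le> card (S \<inter> Y)"
    and t: "1 \<le> t" and n: "q\<^sup>2 + q + 2 * t + 4 \<le> n"
  shows "(\<exists>T. partial_permutation n T \<and> card T = t \<and>
            card (upset n {S \<in> \<S>. \<not> T \<subseteq> S}) + fact (n - t - 2) < t * (n - t - 2) * fact (n - t - 2))
       \<or> (\<exists>z. z \<notin> Y \<and> (\<forall>S\<in>\<S>. t + 1 \<le> card (S \<inter> insert z Y)))"
proof -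
  define cls where "cls y = {S \<in> \<S>. S \<inter> Y = Y - {y}}" for y
  let ?f = "fact (n - t - 2) :: nat"
  have finS: "finite S" if "S \<in> \<S>" for S
    using S(1)[OF that] by (rule partial_permutation_finite)
  have card_Y: "card (Y - {y}) = t" if "y \<in> Y" for y
    using that Y by simp
  have in_cls: "S \<in> cls y" if "S \<in> \<S>" "y \<in> Y" "y \<notin> S" for S y
  proof -
    have "S \<inter> Y = Y - {y}"
      using that Y(1) Y(3)[OF that(1)] card_Y[OF that(2)] by (intro card_seteq) auto
    then show ?thesis
      using that(1) unfolding cls_def by simp
  qed
  have star_cls: "\<exists>y\<in>Y - {y0}. cls y \<noteq> {}" if y0: "y0 \<in> Y" for y0
  proof -
    obtain S where "S \<in> \<S>" "\<not> Y - {y0} \<subseteq> S"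
      using star[OF card_Y[OF y0]] by auto
    then show ?thesis
      using in_cls by blast
  qed
  have pp: "partial_permutation n (Y - {y})" if "cls y \<noteq> {}" for y
    using that S(1) partial_permutation_subset unfolding cls_def by blast
  have div: "card (upset n {S \<in> \<S>. \<not> Y - {y0} \<subseteq> S}) \<le> (\<Sum>y\<in>Y - {y0}. card (upset n (cls y)))" for y0
    using Y(1) in_cls by (intro card_upset_UN_le) auto
  have cross: "S \<inter> (S' - Y) \<noteq> {}" if "S \<in> cls y" "S' \<in> cls y'" "y \<in> Y" "y' \<in> Y" "y \<noteq> y'" for S S' y y'
  proof
    assume "S \<inter> (S' - Y) = {}"
    then have "S \<inter> S' \<subseteq> Y - {y} - {y'}"
      using that(1,2) unfolding cls_def by blast
    then have "card (S \<inter> S') \<le> card (Y - {y} - {y'})"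
      using Y(1) by (intro card_mono) auto
    also have "\<dots> < t"
      using card_Y[OF that(3)] that(4,5) t Y(1) by (simp add: card_Diff_singleton)
    finally show False
      using S(3)[of S S'] that unfolding cls_def by auto
  qed
  have V: "finite (S' - Y)" "card (S' - Y) \<le> q" if "S' \<in> \<S>" for S'
    using finS[OF that] S(2)[OF that] card_mono[of S' "S' - Y"] by auto
  have cls_containing: "{S \<in> cls y. Y - {y} \<subseteq> S} = cls y" for y
    unfolding cls_def by auto
  have fact1: "(fact (n - t - 1) :: nat) = (n - t - 1) * ?f"
    using fact_reduce[of "n - t - 1", where 'a = nat] n by simp
  show ?thesis
  \<comment> \<open>The question is whether some nonempty class has no common cell outside
    \<open>Y\<close>. If so, it serves as a source of branching sets for two levels in every other
    class; the star \<open>Y - {y'}\<close> then omits at most t * q^2 * (n-t-2)! permutations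
    generated by \<S>.\<close>
  proof (cases "\<exists>y'\<in>Y. cls y' \<noteq> {} \<and> (\<forall>z. z \<notin> Y \<longrightarrow> (\<exists>S\<in>cls y'. z \<notin> S))")
    case True
    then obtain y' where y': "y' \<in> Y" "cls y' \<noteq> {}" "\<And>z. z \<notin> Y \<Longrightarrow> \<exists>S\<in>cls y'. z \<notin> S"
      by auto
    have small: "card (upset n (cls y)) \<le> q\<^sup>2 * ?f" if y: "y \<in> Y - {y'}" for y
    proof -
      have "card (upset n {S \<in> cls y. Y - {y} \<subseteq> S}) \<le> q\<^sup>2 * fact (n - card (Y - {y}) - 2)"
      proof (rule card_upset_branch)
        show "finite (Y - {y})"
          using Y(1) by simp
        fix C' assume C': "finite C'" "Y - {y} \<subseteq> C'" "card C' < card (Y - {y}) + 2"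
        show "\<exists>V. finite V \<and> card V \<le> q \<and> V \<inter> C' = {} \<and> (\<forall>S\<in>cls y. C' \<subseteq> S \<longrightarrow> S \<inter> V \<noteq> {})"
        \<comment> \<open>No set in \<open>cls y\<close> contains \<open>y\<close>, so a branch that
          has picked \<open>y\<close> is empty.\<close>
        proof (cases "y \<in> C'")
          case True
          then have "\<not> C' \<subseteq> S" if "S \<in> cls y" for S
            using that y unfolding cls_def by blast
          then show ?thesis
            by (intro exI[of _ "{}"]) auto
        next
          case False
          have "card (C' - (Y - {y})) \<le> 1"
            using C' Y(1) by (subst card_Diff_subset) auto
          then have "x = x'" if "x \<in> C' - (Y - {y})" "x' \<in> C' - (Y - {y})" for x x'
            using C'(1) card_le_Suc0_iff_eq[of "C' - (Y - {y})"] that by auto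
          \<comment> \<open>There may be no extra cell yet; \<open>z\<close> is then arbitrary and
            possibly in \<open>Y\<close>, which the disjunction in the choice of \<open>S'\<close>
            allows for.\<close>
          then have "C' - (Y - {y}) \<subseteq> {SOME x. x \<in> C' - (Y - {y})}"
            by (metis singletonI someI subsetI)
          then obtain z where z: "C' - (Y - {y}) \<subseteq> {z}"
            by blast
          obtain S' where S': "S' \<in> cls y'" "z \<in> Y \<or> z \<notin> S'"
            using y' by blast
          then have "(S' - Y) \<inter> C' = {}"
            using z by auto
          then show ?thesis
            using V[of S'] S'(1) cross[of _ y S' y'] y y'(1)
            by (intro exI[of _ "S' - Y"]) (auto simp: cls_def)
        qed
      qed
      then show ?thesis
        using y unfolding cls_containing by (simp add: card_Y del: card_Diff_insert)
    qed
    have "card (upset n {S \<in> \<S>. \<not> Y - {y'} \<subseteq> S}) \<le> (\<Sum>y\<in>Y - {y'}. q\<^sup>2 * ?f)"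
      using div small by (meson order_trans sum_mono)
    also have "\<dots> = t * q\<^sup>2 * ?f"
      using card_Y[OF y'(1)] by simp
    finally have "card (upset n {S \<in> \<S>. \<not> Y - {y'} \<subseteq> S}) + ?f \<le> (t * q\<^sup>2 + 1) * ?f"
      by simp
    also have "\<dots> < t * (n - t - 2) * ?f"
    proof (rule mult_strict_right_mono)
      have "t * q\<^sup>2 + 1 \<le> t * (q\<^sup>2 + 1)"
        using t by simp
      also have "\<dots> < t * (n - t - 2)"
        using t n by (intro mult_strict_left_mono) auto
      finally show "t * q\<^sup>2 + 1 < t * (n - t - 2)" .
    qed simp
    finally show ?thesis
      using pp[OF y'(2)] card_Y[OF y'(1)] by blast
  next
    case False
    then have common: "\<exists>z. z \<notin> Y \<and> (\<forall>S\<in>cls y. z \<in> S)" if "y \<in> Y" "cls y \<noteq> {}" for y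
      using that by blast
    have full: "card (upset n (cls y)) \<le> fact (n - t - 1)" if y: "y \<in> Y" for y
    proof (cases "cls y = {}")
      case True
      then show ?thesis
        unfolding upset_def by simp
    next
      case False
      then obtain z where z: "z \<notin> Y" "\<And>S. S \<in> cls y \<Longrightarrow> z \<in> S"
        using common[OF y] by auto
      then have "{S \<in> cls y. insert z (Y - {y}) \<subseteq> S} = cls y"
        unfolding cls_def by auto
      moreover have "card (insert z (Y - {y})) = t + 1"
        using z Y(1) card_Y[OF y] by simp
      ultimately show ?thesis
        using card_upset_above_le[of n "cls y" "insert z (Y - {y})"] by simp
    qed
    have "Y \<noteq> {}"
      using Y(2) by auto
    then obtain y1 where y1: "y1 \<in> Y" "cls y1 \<noteq> {}"
      using star_cls by blast
    then obtain z where z: "z \<notin> Y" "\<And>S. S \<in> cls y1 \<Longrightarrow> z \<in> S"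
      using common by blast
    show ?thesis
    \<comment> \<open>Every nonempty class now has a common outer cell. If the cell \<open>z\<close>
      of \<open>cls y1\<close> serves all classes, \<open>insert z Y\<close> is the desired set.
      Otherwise some \<open>S'\<close> in another class misses \<open>z\<close>, and every set in
      \<open>cls y1\<close> meets \<open>S'\<close> at a further cell beyond
      \<open>insert z (Y - {y1})\<close>.\<close>
    proof (cases "\<forall>y\<in>Y. \<forall>S\<in>cls y. z \<in> S")
      case True
      have "t + 1 \<le> card (S \<inter> insert z Y)" if "S \<in> \<S>" for S
      proof (cases "Y \<subseteq> S")
        case True
        then have "card Y \<le> card (S \<inter> insert z Y)"
          using Y(1) by (intro card_mono) auto
        then show ?thesis
          using Y(2) by simp
      next
        case False
        then obtain y where y: "y \<in> Y" "S \<in> cls y"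
          using in_cls \<open>S \<in> \<S>\<close> by blast
        then have "insert z (Y - {y}) \<subseteq> S \<inter> insert z Y"
          using True unfolding cls_def by blast
        then have "card (insert z (Y - {y})) \<le> card (S \<inter> insert z Y)"
          using Y(1) by (intro card_mono) auto
        then show ?thesis
          using z(1) Y(1) card_Y[OF y(1)] by simp
      qed
      then show ?thesis
        using z(1) by blast
    next
      case False
      then obtain y' S' where y': "y' \<in> Y" "S' \<in> cls y'" "z \<notin> S'"
        by auto
      then have ne: "y1 \<noteq> y'"
        using z(2) by auto
      have "card (upset n {S \<in> cls y1. insert z (Y - {y1}) \<subseteq> S}) \<le> q ^ 1 * fact (n - card (insert z (Y - {y1})) - 1)"
      proof (rule card_upset_branch)
        show "finite (insert z (Y - {y1}))"
          using Y(1) by simp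
        fix C' assume C': "finite C'" "insert z (Y - {y1}) \<subseteq> C'" "card C' < card (insert z (Y - {y1})) + 1"
        then have eq: "C' = insert z (Y - {y1})"
          using card_seteq[of C' "insert z (Y - {y1})"] by simp
        show "\<exists>V. finite V \<and> card V \<le> q \<and> V \<inter> C' = {} \<and> (\<forall>S\<in>cls y1. C' \<subseteq> S \<longrightarrow> S \<inter> V \<noteq> {})"
          using V[of S'] y' cross[of _ y1 S' y'] y1(1) ne unfolding eq
          by (intro exI[of _ "S' - Y"]) (auto simp: cls_def)
      qed
      moreover have "{S \<in> cls y1. insert z (Y - {y1}) \<subseteq> S} = cls y1"
        using z unfolding cls_def by auto
      moreover have "card (insert z (Y - {y1})) = t + 1"
        using z Y(1) card_Y[OF y1(1)] by simp
      ultimately have small: "card (upset n (cls y1)) \<le> q * ?f"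
        by (simp add: numeral_2_eq_2)
      have "card (upset n {S \<in> \<S>. \<not> Y - {y'} \<subseteq> S}) \<le> (\<Sum>y\<in>Y - {y'}. card (upset n (cls y)))"
        by (rule div)
      also have "\<dots> = card (upset n (cls y1)) + (\<Sum>y\<in>Y - {y'} - {y1}. card (upset n (cls y)))"
        using Y(1) y1(1) ne by (intro sum.remove) auto
      \<comment> \<open>Of the \<open>t\<close> classes omitted by the star \<open>Y - {y'}\<close>,
        one drops from order (n-t-1)! to q * (n-t-2)!, which is what makes the inequality
        strict.\<close>
      also have "\<dots> \<le> q * ?f + (\<Sum>y\<in>Y - {y'} - {y1}. fact (n - t - 1))"
        using small full by (intro add_mono sum_mono) auto
      also have "\<dots> = (q + (t - 1) * (n - t - 1)) * ?f"
      proof -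
        have "card (Y - {y'} - {y1}) = t - 1"
          using card_Y[OF y'(1)] y1(1) ne Y(1) by (simp add: card_Diff_singleton)
        then show ?thesis
          unfolding fact1 sum_constant by (simp only: of_nat_id add_mult_distrib mult.assoc)
      qed
      finally have "card (upset n {S \<in> \<S>. \<not> Y - {y'} \<subseteq> S}) + ?f \<le> (q + (t - 1) * (n - t - 1) + 1) * ?f"
        by simp
      also have "\<dots> < t * (n - t - 2) * ?f"
      proof (rule mult_strict_right_mono)
        obtain u where u: "t = Suc u"
          using t by (cases t) auto
        obtain d where d: "n = q + 2 * t + 4 + d"
          using n by (metis add.assoc add.commute le_iff_add power2_eq_square)
        show "q + (t - 1) * (n - t - 1) + 1 < t * (n - t - 2)"
          unfolding d u by (simp add: algebra_simps)
      qed simp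
      finally show ?thesis
        using pp[of y'] y'(2) card_Y[OF y'(1)] by blast
    qed
  qed
qed

text \<open>The first bound feeds all branching estimates; in the second, the summand 1 pays for the
  (n-t-2)! members lost in the approximation.\<close>

lemma size_bounds:
  fixes t n :: nat
  assumes "1 \<le> t" "6 * (t + 4) ^ 4 \<le> n"
  shows "(6 * t + 11)\<^sup>2 + (6 * t + 11) + 2 * t + 4 \<le> n"
    and "((t + 2) choose t) * (6 * t + 11)\<^sup>2 + 1 < t * (n - t - 2)"
proof -
  obtain u where u: "t = Suc u"
    using assms(1) by (cases t) auto
  obtain d where d: "n = 6 * (t + 4) ^ 4 + d"
    using assms(2) le_iff_add by blast
  show "(6 * t + 11)\<^sup>2 + (6 * t + 11) + 2 * t + 4 \<le> n"
    unfolding d u by (simp add: power4_eq_xxxx power2_eq_square algebra_simps)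
  have "(t + 2) choose t = ((t + 2) * (t + 1)) div 2"
    using binomial_symmetric[of 2 "t + 2"] by (simp add: choose_two)
  then have "2 * ((t + 2) choose t) \<le> (t + 2) * (t + 1)"
    by simp
  then have "2 * ((t + 2) choose t) * (6 * t + 11)\<^sup>2 \<le> (t + 2) * (t + 1) * (6 * t + 11)\<^sup>2"
    by (rule mult_le_mono1)
  then have "2 * (((t + 2) choose t) * (6 * t + 11)\<^sup>2 + 1) \<le> (t + 2) * (t + 1) * (6 * t + 11)\<^sup>2 + 2"
    by (simp only: distrib_left mult.assoc mult_1_right add_le_cancel_right)
  also have "\<dots> < 2 * (t * (n - t - 2))"
  proof -
    have "n - t - 2 \<ge> 6 * (t + 4) ^ 4 - t - 2"
      unfolding d by simp
    then have le: "2 * (t * (6 * (t + 4) ^ 4 - t - 2)) \<le> 2 * (t * (n - t - 2))"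
      by simp
    \<comment> \<open>6(u+5)^4 - (u+3) expanded, so that the comparison is between polynomials in
      \<open>u\<close> without subtraction.\<close>
    have eq: "6 * (t + 4) ^ 4 - t - 2 = 6 * u ^ 4 + 120 * u ^ 3 + 900 * u\<^sup>2 + 2999 * u + 3747"
      unfolding u by (simp add: power4_eq_xxxx power3_eq_cube power2_eq_square algebra_simps)
    have "(t + 2) * (t + 1) * (6 * t + 11)\<^sup>2 + 2
        < 2 * (t * (6 * u ^ 4 + 120 * u ^ 3 + 900 * u\<^sup>2 + 2999 * u + 3747))"
      unfolding u by (simp add: power4_eq_xxxx power3_eq_cube power2_eq_square algebra_simps)
    then show ?thesis
      using le unfolding eq by (rule less_le_trans)
  qed
  finally show "((t + 2) choose t) * (6 * t + 11)\<^sup>2 + 1 < t * (n - t - 2)"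
    by simp
qed

text \<open>The two cells may coincide: a cell outside the grid conflicts with itself.\<close>

lemma not_partial_permutation_pair:
  assumes "\<not> partial_permutation n X"
  obtains a b where "a \<in> X" "b \<in> X" "\<not> partial_permutation n {a, b}"
proof -
  have "\<exists>a\<in>X. \<exists>b\<in>X. \<not> partial_permutation n {a, b}"
    using assms unfolding partial_permutation_iff inj_on_def by simp blast
  then show ?thesis
    using that by blast
qed

text \<open>The cases follow the least size of a set meeting every \<open>S\<close> in at least
  \<open>t\<close> cells. Size \<open>t\<close> is a common star, size \<open>t + 1\<close> is the
  dichotomy above, and from \<open>t + 2\<close> on the branching bound makes all of
  \<open>upset n \<S>\<close> small, so any star will do.\<close>

lemma intersecting_structure:
  fixes \<S> :: "(nat \<times> nat) set set"
  assumes S: "\<And>S. S \<in> \<S> \<Longrightarrow> partial_permutation n S" "\<And>S. S \<in> \<S> \<Longrightarrow> card S \<le> 6 * t + 11"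
    "\<And>S S'. S \<in> \<S> \<Longrightarrow> S' \<in> \<S> \<Longrightarrow> t \<le> card (S \<inter> S')"
    and t: "1 \<le> t" and n: "6 * (t + 4) ^ 4 \<le> n"
  shows "(\<exists>T. partial_permutation n T \<and> card T = t \<and>
            card (upset n {S \<in> \<S>. \<not> T \<subseteq> S}) + fact (n - t - 2) < t * (n - t - 2) * fact (n - t - 2))
       \<or> (\<exists>X. partial_permutation n X \<and> card X = t + 2 \<and> (\<forall>S\<in>\<S>. t + 1 \<le> card (S \<inter> X)))"
    (is "(\<exists>T. ?small T) \<or> _")
proof -
  let ?q = "6 * t + 11"
  let ?f = "fact (n - t - 2) :: nat"
  note bounds = size_bounds[OF t n]
  have finS: "finite S" if "S \<in> \<S>" for S
    using S(1)[OF that] by (rule partial_permutation_finite)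
  obtain T0 where T0: "partial_permutation n T0" "card T0 = t"
    using partial_permutation_exists[of t n] bounds(1) by auto
  have pos: "?f < t * (n - t - 2) * ?f"
    using mult_strict_right_mono[of 1 "t * (n - t - 2)" ?f] bounds(2) by simp
  show ?thesis
  proof (cases "\<exists>T. card T = t \<and> (\<forall>S\<in>\<S>. T \<subseteq> S)")
    case True
    then obtain T where T: "card T = t" "\<forall>S\<in>\<S>. T \<subseteq> S"
      by auto
    show ?thesis
    proof (cases "\<S> = {}")
      case True
      then have "?small T0"
        using T0 pos unfolding upset_def by simp
      then show ?thesis
        by blast
    next
      case False
      then have "partial_permutation n T"
        using T(2) S(1) partial_permutation_subset by blast
      moreover have "upset n {S \<in> \<S>. \<not> T \<subseteq> S} = {}"
        using T(2) unfolding upset_def by auto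
      ultimately have "?small T"
        using T(1) pos by simp
      then show ?thesis
        by blast
    qed
  next
    case False
    then have star: "\<And>T. card T = t \<Longrightarrow> \<exists>S\<in>\<S>. \<not> T \<subseteq> S"
      by blast
    show ?thesis
    proof (cases "\<exists>Y. finite Y \<and> card Y = t + 1 \<and> (\<forall>S\<in>\<S>. t \<le> card (S \<inter> Y))")
      case True
      then obtain Y where Y: "finite Y" "card Y = t + 1" "\<And>S. S \<in> \<S> \<Longrightarrow> t \<le> card (S \<inter> Y)"
        by blast
      consider "\<exists>T. ?small T" | z where "z \<notin> Y" "\<forall>S\<in>\<S>. t + 1 \<le> card (S \<inter> insert z Y)"
        using near_cover_dichotomy[OF S star Y t bounds(1)] by blast
      then show ?thesis
      proof cases
        case 2
        define X where "X = insert z Y"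
        have X: "finite X" "card X = t + 2" "\<And>S. S \<in> \<S> \<Longrightarrow> t + 1 \<le> card (S \<inter> X)"
          using 2 Y(1,2) unfolding X_def by auto
        \<comment> \<open>If \<open>a\<close> and \<open>b\<close> conflict, no \<open>S\<close>
          contains both. As each \<open>S\<close> misses at most one cell of \<open>X\<close>, that
          cell is \<open>a\<close> or \<open>b\<close>, so all sets share at least \<open>t\<close>
          cells of \<open>X\<close>, a common star that is already excluded.\<close>
        have "partial_permutation n X"
        proof (rule ccontr)
          assume "\<not> partial_permutation n X"
          then obtain a b where ab: "a \<in> X" "b \<in> X" "\<not> partial_permutation n {a, b}"
            by (rule not_partial_permutation_pair)
          have "card (X - {a, b}) \<ge> t"
            using diff_card_le_card_Diff[of "{a, b}" X] X(2) card_insert_le_m1[of 2 "{b}" a] by simp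
          then obtain T where T: "T \<subseteq> X - {a, b}" "card T = t"
            using obtain_subset_with_card_n by metis
          have "T \<subseteq> S" if "S \<in> \<S>" for S
          proof -
            have "\<not> {a, b} \<subseteq> S"
              using S(1)[OF that] ab(3) partial_permutation_subset by blast
            then obtain c where c: "c \<in> {a, b}" "c \<notin> S"
              by blast
            then have "c \<in> X"
              using ab by auto
            then have "S \<inter> X = X - {c}"
              using X(1,2) X(3)[OF that] c(2) by (intro card_seteq) auto
            then show ?thesis
              using T(1) c(1) by blast
          qed
          then show False
            using star[OF T(2)] by blast
        qed
        then show ?thesis
          using X by blast
      qed blast
    next
      case False
      define cover where "cover C \<longleftrightarrow> finite C \<and> (\<forall>S\<in>\<S>. t \<le> card (C \<inter> S))" for C
      have no_cover: "\<not> cover C" if C: "card C < t + 2" for C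
      proof
        assume "cover C"
        then have C': "finite C" "\<And>S. S \<in> \<S> \<Longrightarrow> t \<le> card (C \<inter> S)"
          unfolding cover_def by auto
        \<comment> \<open>Covers are arbitrary sets of pairs, so a smaller cover can be padded to
          size exactly \<open>t + 1\<close>, with cells outside the grid if necessary.\<close>
        have "infinite (UNIV - C)"
          using C'(1) infinite_UNIV_nat
          by (intro Diff_infinite_finite) (auto simp: finite_cartesian_product_iff simp flip: UNIV_Times_UNIV)
        then obtain Z where Z: "finite Z" "card Z = t + 1 - card C" "Z \<subseteq> UNIV - C"
          using infinite_arbitrarily_large by metis
        then have "card (C \<union> Z) = t + 1"
          using C C'(1) by (subst card_Un_disjoint) auto
        moreover have "t \<le> card (S \<inter> (C \<union> Z))" if "S \<in> \<S>" for S
          using C'(2)[OF that] card_mono[of "S \<inter> (C \<union> Z)" "C \<inter> S"] finS[OF that] by fastforce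
        ultimately show False
          using False C'(1) Z(1) by blast
      qed
      obtain S0 where S0: "S0 \<in> \<S>"
        using star[OF T0(2)] by auto
      have "cover S0"
        using S0 S(3) finS unfolding cover_def by auto
      then obtain C where C: "cover C" "\<And>C'. cover C' \<Longrightarrow> card C \<le> card C'"
        using ex_has_least_nat[of cover S0 card] by auto
      have "t + 2 \<le> card C"
        using no_cover[of C] C(1) by linarith
      moreover have "card C \<le> ?q"
        using C(2)[OF \<open>cover S0\<close>] S(2)[OF S0] by linarith
      ultimately obtain r where r: "card C = t + r" "2 \<le> r" "t + r \<le> ?q"
        using le_Suc_ex[of t "card C"] by auto
      have "card (upset n \<S>) \<le> ((t + r) choose t) * (?q ^ r * fact (n - t - r))"
      proof (rule card_upset_min_cover[OF finS S(2,3)])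
        show "finite C" "\<And>S. S \<in> \<S> \<Longrightarrow> t \<le> card (C \<inter> S)"
          using C(1) unfolding cover_def by auto
        show "\<exists>S\<in>\<S>. card (C' \<inter> S) < t" if "finite C'" "card C' < t + r" for C'
        proof (rule ccontr)
          assume "\<not> ?thesis"
          then have "cover C'"
            unfolding cover_def using that(1) by (auto simp: not_less)
          then show False
            using C(2)[of C'] r(1) that(2) by linarith
        qed
      qed (use r in auto)
      also have "\<dots> \<le> ((t + 2) choose t) * (?q\<^sup>2 * ?f)"
        using r bounds(1) by (intro cover_bound_antimono) auto
      finally have "card (upset n {S \<in> \<S>. \<not> T0 \<subseteq> S}) \<le> ((t + 2) choose t) * ?q\<^sup>2 * ?f"
        using card_upset_mono[of "{S \<in> \<S>. \<not> T0 \<subseteq> S}" \<S> n] by (simp add: mult.assoc)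
      then have "card (upset n {S \<in> \<S>. \<not> T0 \<subseteq> S}) + ?f \<le> (((t + 2) choose t) * ?q\<^sup>2 + 1) * ?f"
        by simp
      also have "\<dots> < t * (n - t - 2) * ?f"
        using bounds(2) by (intro mult_strict_right_mono) auto
      finally show ?thesis
        using T0 by blast
    qed
  qed
qed

section \<open>Permutations avoiding a given one\<close>

lemma sum_card_swap:
  assumes "finite A" "finite B"
  shows "(\<Sum>a\<in>A. card {b \<in> B. R a b}) = (\<Sum>b\<in>B. card {a \<in> A. R a b})"
proof -
  have "(\<Sum>a\<in>A. card {b \<in> B. R a b}) = (\<Sum>a\<in>A. \<Sum>b\<in>B. if R a b then 1 else 0)"
    using assms by (simp add: sum.If_cases Int_def)
  also have "\<dots> = (\<Sum>b\<in>B. \<Sum>a\<in>A. if R a b then 1 else 0)"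
    by (rule sum.swap)
  finally show ?thesis
    using assms by (simp add: sum.If_cases Int_def)
qed

lemma real_choose_2: "real (x choose 2) = real x * (real x - 1) / 2"
  by (induction x) (auto simp: numeral_2_eq_2 field_simps)

lemma real_choose_3: "real (x choose 3) = real x * (real x - 1) * (real x - 2) / 6"
proof (induction x)
  case (Suc x)
  have "Suc x choose 3 = (x choose 2) + (x choose 3)"
    by (simp add: numeral_3_eq_3 numeral_2_eq_2)
  then show ?case
    using Suc real_choose_2[of x] by (simp add: field_simps)
qed simp

text \<open>The truncated alternating sum equals -(x-1)(x-2)(x-3)/6, which is 1 at 0 and never
  positive at a positive integer.\<close>

lemma bonferroni_indicator:
  "1 - real x + real (x choose 2) - real (x choose 3) \<le> (if x = 0 then 1 else 0)"
proof (cases "x = 0")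
  case False
  then consider "x = 1" | "x = 2" | "3 \<le> x"
    by linarith
  then have "0 \<le> (real x - 1) * (real x - 2) * (real x - 3)"
    by cases auto
  moreover have "1 - real x + real (x choose 2) - real (x choose 3)
      = - ((real x - 1) * (real x - 2) * (real x - 3)) / 6"
    unfolding real_choose_2 real_choose_3 by (simp add: field_simps)
  ultimately show ?thesis
    using False by simp
qed (simp add: binomial_eq_0)

text \<open>Equality holds at j = m, where 1 - 1 + 1/2 - 1/6 = 1/3. Once j - 2 in the cubic term is
  replaced by m - 2, the difference is a positive multiple of (m-2)(m-j)(2m-j-2).\<close>

lemma bonferroni_third:
  fixes j m :: real
  assumes "j \<le> m" "2 \<le> m" "0 \<le> j * (j - 1)"
  shows "m * (m - 1) * (m - 2) / 3 \<le> m * (m - 1) * (m - 2) - j * (m - 1) * (m - 2)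
      + j * (j - 1) / 2 * (m - 2) - j * (j - 1) * (j - 2) / 6"
proof -
  have "j * (j - 1) * (j - 2) \<le> j * (j - 1) * (m - 2)"
    using assms by (intro mult_left_mono) auto
  moreover have "0 \<le> (m - 2) * ((m - j) * (m + (m - j) - 2))"
    using assms by (intro mult_nonneg_nonneg) auto
  ultimately show ?thesis
    by (simp add: field_simps)
qed

text \<open>A derangement count: third-order inclusion-exclusion over the cells of \<open>F0\<close>
  that a permutation through \<open>C\<close> can still hit outside \<open>C\<close>. The worst case
  has n - |C| such cells.\<close>

lemma card_avoiding_ge:
  assumes C: "partial_permutation n C" and F0: "F0 \<in> Sigma_perms n" and m: "card C + 3 \<le> n"
  shows "fact (n - card C) \<le> 3 * card {G \<in> Sigma_perms n. C \<subseteq> G \<and> G \<inter> F0 \<subseteq> C}"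
proof -
  define m where "m = n - card C"
  define J where "J = {v \<in> F0. fst v \<notin> fst ` C \<and> snd v \<notin> snd ` C}"
  define \<G> where "\<G> = {G \<in> Sigma_perms n. C \<subseteq> G}"
  define X where "X G = card (G \<inter> J)" for G
  have fin: "finite C" "finite J" "finite \<G>"
    using C F0 partial_permutation_finite finite_Sigma_perms_member unfolding J_def \<G>_def by auto
  have pp: "partial_permutation n (C \<union> P)" and disj: "C \<inter> P = {}" if "P \<subseteq> J" for P
  proof -
    have "partial_permutation n J"
      using F0 unfolding J_def partial_permutation_def by blast
    then have "partial_permutation n P"
      using that by (rule partial_permutation_subset)
    moreover have out: "fst v \<notin> fst ` C \<and> snd v \<notin> snd ` C" if "v \<in> P" for v
      using that \<open>P \<subseteq> J\<close> unfolding J_def by auto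
    have "fst ` C \<inter> fst ` P = {}"
      using out by (metis disjoint_iff imageE)
    moreover have "snd ` C \<inter> snd ` P = {}"
      using out by (metis disjoint_iff imageE)
    ultimately show "partial_permutation n (C \<union> P)"
      using C unfolding partial_permutation_iff inj_on_Un by blast
    show "C \<inter> P = {}"
      using that unfolding J_def by auto
  qed
  have j: "card J \<le> m"
  proof -
    have "card C + card J = card (C \<union> J)"
      using fin disj by (simp add: card_Un_disjoint)
    also have "\<dots> \<le> n"
      by (rule partial_permutation_card_le[OF pp]) simp
    finally show ?thesis
      unfolding m_def by simp
  qed
  \<comment> \<open>Every subset of \<open>J\<close> is compatible with \<open>C\<close>, so the
    binomial moments of \<open>X\<close> are exact rather than bounds.\<close>
  have moment: "(\<Sum>G\<in>\<G>. X G choose k) = (card J choose k) * fact (m - k)" for k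
  proof -
    let ?P = "{P. P \<subseteq> J \<and> card P = k}"
    have "(\<Sum>G\<in>\<G>. X G choose k) = (\<Sum>G\<in>\<G>. card {P \<in> ?P. P \<subseteq> G})"
    proof (rule sum.cong[OF refl])
      fix G
      have "{P \<in> ?P. P \<subseteq> G} = {P. P \<subseteq> G \<inter> J \<and> card P = k}"
        by auto
      then show "X G choose k = card {P \<in> ?P. P \<subseteq> G}"
        using n_subsets[of "G \<inter> J" k] fin(2) unfolding X_def by (metis finite_Int)
    qed
    also have "\<dots> = (\<Sum>P\<in>?P. card {G \<in> \<G>. P \<subseteq> G})"
      using fin by (intro sum_card_swap) auto
    also have "\<dots> = (\<Sum>P\<in>?P. fact (m - k))"
    proof (rule sum.cong[OF refl])
      fix P assume P: "P \<in> ?P"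
      have "{G \<in> \<G>. P \<subseteq> G} = {G \<in> Sigma_perms n. C \<union> P \<subseteq> G}"
        unfolding \<G>_def by auto
      moreover have "card (C \<union> P) = card C + k"
        using P fin disj[of P] finite_subset[of P J] by (simp add: card_Un_disjoint)
      ultimately show "card {G \<in> \<G>. P \<subseteq> G} = fact (m - k)"
        using card_supersets[OF pp[of P]] P unfolding m_def by simp
    qed
    finally show ?thesis
      using fin(2) by (simp add: n_subsets)
  qed
  define g where "g = (fact (m - 3) :: real)"
  have m3: "3 \<le> m"
    using m unfolding m_def by simp
  have facts: "fact (m - 2) = (real m - 2) * g" "fact (m - 1) = (real m - 1) * (real m - 2) * g"
    "fact m = real m * (real m - 1) * (real m - 2) * g"
  proof -
    obtain u where "m = Suc (Suc (Suc u))"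
      using m3 that[of "m - 3"] by simp
    then show "fact (m - 2) = (real m - 2) * g" "fact (m - 1) = (real m - 1) * (real m - 2) * g"
      "fact m = real m * (real m - 1) * (real m - 2) * g"
      unfolding g_def by (simp_all add: algebra_simps)
  qed
  have rmoment: "(\<Sum>G\<in>\<G>. real (X G choose k)) = real (card J choose k) * fact (m - k)" for k
    using moment[of k] by (metis of_nat_fact of_nat_mult of_nat_sum)
  have "fact m / 3 = (real m * (real m - 1) * (real m - 2) / 3) * g"
    unfolding facts by simp
  also have "\<dots> \<le> (real m * (real m - 1) * (real m - 2) - real (card J) * (real m - 1) * (real m - 2)
      + real (card J) * (real (card J) - 1) / 2 * (real m - 2)
      - real (card J) * (real (card J) - 1) * (real (card J) - 2) / 6) * g"
  proof (intro mult_right_mono bonferroni_third)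
    show "0 \<le> real (card J) * (real (card J) - 1)"
      by (cases "card J") auto
  qed (use j m3 in \<open>auto simp: g_def\<close>)
  also have "\<dots> = real (card J choose 0) * fact (m - 0) - real (card J choose 1) * fact (m - 1)
      + real (card J choose 2) * fact (m - 2) - real (card J choose 3) * fact (m - 3)"
    unfolding real_choose_2 real_choose_3 g_def[symmetric] diff_zero binomial_n_0 choose_one facts
    by (simp add: algebra_simps)
  also have "\<dots> = (\<Sum>G\<in>\<G>. 1 - real (X G) + real (X G choose 2) - real (X G choose 3))"
    unfolding rmoment[symmetric] by (simp add: sum.distrib sum_subtractf)
  also have "\<dots> \<le> (\<Sum>G\<in>\<G>. if X G = 0 then 1 else 0)"
    by (intro sum_mono bonferroni_indicator)
  also have "\<dots> = real (card {G \<in> \<G>. X G = 0})"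
    using fin(3) by (simp add: sum.If_cases Int_def)
  also have "\<dots> \<le> real (card {G \<in> Sigma_perms n. C \<subseteq> G \<and> G \<inter> F0 \<subseteq> C})"
  proof -
    have "{G \<in> \<G>. X G = 0} \<subseteq> {G \<in> Sigma_perms n. C \<subseteq> G \<and> G \<inter> F0 \<subseteq> C}"
    proof
      fix G assume "G \<in> {G \<in> \<G>. X G = 0}"
      then have G': "G \<in> Sigma_perms n" "C \<subseteq> G" "G \<inter> J = {}"
        using fin(2) unfolding \<G>_def X_def by auto
      have "v \<in> C" if v: "v \<in> G" "v \<in> F0" for v
      proof (rule ccontr)
        assume "v \<notin> C"
        have "fst v \<noteq> fst c \<and> snd v \<noteq> snd c" if "c \<in> C" for c
          using that \<open>v \<notin> C\<close> v(1) G'(2) inj_onD[OF inj_on_fst_Sigma_perms[OF G'(1)], of v c]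
            inj_onD[OF inj_on_snd_Sigma_perms[OF G'(1)], of v c] by blast
        then have "fst v \<notin> fst ` C" "snd v \<notin> snd ` C"
          by blast+
        then show False
          using v G'(3) unfolding J_def by auto
      qed
      then show "G \<in> {G \<in> Sigma_perms n. C \<subseteq> G \<and> G \<inter> F0 \<subseteq> C}"
        using G' by auto
    qed
    then show ?thesis
      by (simp add: card_mono)
  qed
  finally have "real (fact m) \<le> real (3 * card {G \<in> Sigma_perms n. C \<subseteq> G \<and> G \<inter> F0 \<subseteq> C})"
    by simp
  then show ?thesis
    unfolding m_def by (simp only: of_nat_le_iff)
qed

section \<open>Star diversity\<close>

lemma finite_star_values:
  "finite {card {F \<in> \<F>. \<not> T \<subseteq> F} | T. partial_permutation n T \<and> card T = t}"
proof -
  have "{T. partial_permutation n T} \<subseteq> Pow ({1..n} \<times> {1..n})"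
    by (auto simp: partial_permutation_iff)
  then have "finite {T. partial_permutation n T}"
    by (rule finite_subset) simp
  then have "finite ((\<lambda>T. card {F \<in> \<F>. \<not> T \<subseteq> F}) ` {T. partial_permutation n T})"
    by simp
  then show ?thesis
    by (rule rev_finite_subset) auto
qed

lemma star_diversity_le:
  assumes "partial_permutation n T" "card T = t"
  shows "star_diversity n t \<F> \<le> card {F \<in> \<F>. \<not> T \<subseteq> F}"
  unfolding star_diversity_def using assms by (intro Min_le finite_star_values) auto

lemma star_diversity_attained:
  assumes "t \<le> n"
  obtains T where "partial_permutation n T" "card T = t"
    "star_diversity n t \<F> = card {F \<in> \<F>. \<not> T \<subseteq> F}"
proof -
  have "star_diversity n t \<F> \<in> {card {F \<in> \<F>. \<not> T \<subseteq> F} | T. partial_permutation n T \<and> card T = t}"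
    unfolding star_diversity_def
    using partial_permutation_exists[OF assms] by (intro Min_in finite_star_values) auto
  then show ?thesis
    using that by blast
qed

section \<open>Layers of permutations missing exactly one cell of \<open>X\<close>\<close>

definition missing_one :: "nat \<Rightarrow> (nat \<times> nat) set \<Rightarrow> nat \<times> nat \<Rightarrow> (nat \<times> nat) set set" where
  "missing_one n X x = {F \<in> Sigma_perms n. F \<inter> X = X - {x}}"

lemma finite_missing_one [simp]: "finite (missing_one n X x)"
  unfolding missing_one_def by simp

lemma missing_one_disjoint: "x \<in> X \<Longrightarrow> y \<in> X \<Longrightarrow> x \<noteq> y \<Longrightarrow> missing_one n X x \<inter> missing_one n X y = {}"
  unfolding missing_one_def by auto

lemma card_missing_one:
  assumes X: "partial_permutation n X" "card X = t + 2" and "x \<in> X"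
  shows "card (missing_one n X x) = (n - t - 2) * fact (n - t - 2)"
proof -
  have n: "t + 2 \<le> n"
    using partial_permutation_card_le[OF X(1)] X(2) by simp
  have fin: "finite X"
    using X(1) by (rule partial_permutation_finite)
  have "missing_one n X x = {F \<in> Sigma_perms n. X - {x} \<subseteq> F} - {F \<in> Sigma_perms n. X \<subseteq> F}"
    using \<open>x \<in> X\<close> unfolding missing_one_def by blast
  moreover have "card (X - {x}) = t + 1"
    using X(2) \<open>x \<in> X\<close> fin by simp
  then have "card {F \<in> Sigma_perms n. X - {x} \<subseteq> F} = fact (n - t - 1)"
    using card_supersets[OF partial_permutation_subset[OF X(1), of "X - {x}"]] by simp
  moreover have "card {F \<in> Sigma_perms n. X \<subseteq> F} = fact (n - t - 2)"
    using card_supersets[OF X(1)] X(2) by simp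
  moreover have "{F \<in> Sigma_perms n. X \<subseteq> F} \<subseteq> {F \<in> Sigma_perms n. X - {x} \<subseteq> F}"
    by auto
  ultimately have "card (missing_one n X x) = fact (n - t - 1) - fact (n - t - 2)"
    by (simp add: card_Diff_subset)
  also have "(fact (n - t - 1) :: nat) = (n - t - 1) * fact (n - t - 2)"
    using fact_reduce[of "n - t - 1", where 'a = nat] n by simp
  also have "(n - t - 1) * fact (n - t - 2) - fact (n - t - 2) = (n - t - 2) * fact (n - t - 2)"
  proof -
    have "n - t - 1 = Suc (n - t - 2)"
      using n by simp
    then show ?thesis
      by simp
  qed
  finally show ?thesis .
qed

lemma missing_oneI:
  assumes "finite X" "card X = t + 2" "F \<in> Sigma_perms n" "t + 1 \<le> card (F \<inter> X)" "x \<in> X" "x \<notin> F"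
  shows "F \<in> missing_one n X x"
proof -
  have "F \<inter> X = X - {x}"
    using assms by (intro card_seteq) auto
  then show ?thesis
    using assms(3) unfolding missing_one_def by simp
qed

lemma card_inter_missing_one:
  assumes "finite X" "card X = t + 2" "x \<in> X" "F \<in> missing_one n X x"
  shows "card (F \<inter> X) = t + 1"
proof -
  have "F \<inter> X = X - {x}"
    using assms(4) unfolding missing_one_def by blast
  then show ?thesis
    using assms(1-3) by simp
qed

lemma near_supersets_outside:
  assumes X: "partial_permutation n X" "card X = t + 2" and T: "T \<subseteq> X"
  shows "{F \<in> Sigma_perms n. t + 1 \<le> card (F \<inter> X) \<and> \<not> T \<subseteq> F} = (\<Union>x\<in>T. missing_one n X x)" (is "?L = ?R")
proof
  have fin: "finite X"
    using X(1) by (rule partial_permutation_finite)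
  show "?L \<subseteq> ?R"
    using missing_oneI[OF fin X(2)] T by blast
  show "?R \<subseteq> ?L"
  proof
    fix F assume "F \<in> ?R"
    then obtain x where x: "x \<in> T" "F \<in> missing_one n X x"
      by blast
    moreover have "x \<in> X"
      using T x(1) by blast
    moreover have "F \<in> Sigma_perms n" "x \<notin> F"
      using x(2) \<open>x \<in> X\<close> unfolding missing_one_def by blast+
    ultimately show "F \<in> ?L"
      using card_inter_missing_one[OF fin X(2), of x F n] by auto
  qed
qed

lemma card_UN_missing_one:
  assumes X: "partial_permutation n X" "card X = t + 2" and T: "T \<subseteq> X"
  shows "card (\<Union>x\<in>T. missing_one n X x) = card T * (n - t - 2) * fact (n - t - 2)"
proof -
  have "finite T"
    using T partial_permutation_finite[OF X(1)] finite_subset by auto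
  then have "card (\<Union>x\<in>T. missing_one n X x) = (\<Sum>x\<in>T. card (missing_one n X x))"
    using T by (intro card_UN_disjoint ballI impI missing_one_disjoint) auto
  also have "\<dots> = (\<Sum>x\<in>T. (n - t - 2) * fact (n - t - 2))"
    using T card_missing_one[OF X] by (intro sum.cong) auto
  finally show ?thesis
    by simp
qed

lemma level_eq_UN_missing_one:
  assumes X: "finite X" "card X = t + 2"
  shows "{F \<in> Sigma_perms n. card (F \<inter> X) = t + 1} = (\<Union>x\<in>X. missing_one n X x)" (is "?L = ?R")
proof
  show "?L \<subseteq> ?R"
  proof clarify
    fix F assume F: "F \<in> Sigma_perms n" "card (F \<inter> X) = t + 1"
    then have "\<not> X \<subseteq> F"
      using X(2) by (auto simp: Int_absorb1)
    then obtain x where "x \<in> X" "x \<notin> F"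
      by auto
    then show "F \<in> ?R"
      using missing_oneI[OF X F(1), of x] F(2) by auto
  qed
  show "?R \<subseteq> ?L"
    using card_inter_missing_one[OF X] unfolding missing_one_def by blast
qed

text \<open>A star inside \<open>X\<close> omits exactly \<open>t\<close> layers. Any other star has
  a cell \<open>v\<close> outside \<open>X\<close>; in each of the \<open>t + 2\<close> layers at
  most (n-t-2)! permutations contain \<open>v\<close>, so it omits at least (t+2)(n-t-3)(n-t-2)!,
  which is no less than the claimed value as n >= 3t+6.\<close>

lemma star_diversity_extremal:
  assumes t: "1 \<le> t" and n: "3 * t + 6 \<le> n"
    and X: "partial_permutation n X" "card X = t + 2"
    and \<F>: "{F \<in> Sigma_perms n. card (F \<inter> X) = t + 1} \<subseteq> \<F>"
      "\<F> \<subseteq> {F \<in> Sigma_perms n. t + 1 \<le> card (F \<inter> X)}"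
  shows "star_diversity n t \<F> = t * (n - t - 2) * fact (n - t - 2)"
proof -
  let ?f = "fact (n - t - 2) :: nat"
  have fin: "finite X" "finite \<F>"
    using X(1) partial_permutation_finite finite_subset[OF \<F>(2)] by auto
  have miss: "missing_one n X x \<subseteq> \<F>" if "x \<in> X" for x
    using level_eq_UN_missing_one[OF fin(1) X(2), of n] \<F>(1) that by blast
  have inside: "card {F \<in> \<F>. \<not> T \<subseteq> F} = t * (n - t - 2) * ?f" if T: "T \<subseteq> X" "card T = t" for T
  proof -
    have "{F \<in> \<F>. \<not> T \<subseteq> F} = (\<Union>x\<in>T. missing_one n X x)"
    proof
      show "{F \<in> \<F>. \<not> T \<subseteq> F} \<subseteq> (\<Union>x\<in>T. missing_one n X x)"
        using \<F>(2) near_supersets_outside[OF X T(1)] by blast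
      show "(\<Union>x\<in>T. missing_one n X x) \<subseteq> {F \<in> \<F>. \<not> T \<subseteq> F}"
        using near_supersets_outside[OF X T(1)] miss T(1) by blast
    qed
    then show ?thesis
      using card_UN_missing_one[OF X T(1)] T(2) by simp
  qed
  have outside: "t * (n - t - 2) * ?f \<le> card {F \<in> \<F>. \<not> T \<subseteq> F}"
    if T: "card T = t" "\<not> T \<subseteq> X" for T
  proof -
    obtain v where v: "v \<in> T" "v \<notin> X"
      using T(2) by auto
    define A where "A x = missing_one n X x - {F \<in> Sigma_perms n. insert v (X - {x}) \<subseteq> F}" for x
    have "(\<Union>x\<in>X. A x) \<subseteq> {F \<in> \<F>. \<not> T \<subseteq> F}"
    proof
      fix F assume "F \<in> (\<Union>x\<in>X. A x)"
      then obtain x where x: "x \<in> X" "F \<in> missing_one n X x" "F \<notin> {F \<in> Sigma_perms n. insert v (X - {x}) \<subseteq> F}"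
        unfolding A_def by auto
      then have "v \<notin> F"
        unfolding missing_one_def by blast
      then show "F \<in> {F \<in> \<F>. \<not> T \<subseteq> F}"
        using miss[OF x(1)] x(2) v(1) by blast
    qed
    then have "card (\<Union>x\<in>X. A x) \<le> card {F \<in> \<F>. \<not> T \<subseteq> F}"
      using fin(2) by (intro card_mono) auto
    moreover have "card (\<Union>x\<in>X. A x) = (\<Sum>x\<in>X. card (A x))"
    proof (rule card_UN_disjoint[OF fin(1)])
      show "\<forall>x\<in>X. finite (A x)"
        unfolding A_def by simp
      show "\<forall>x\<in>X. \<forall>y\<in>X. x \<noteq> y \<longrightarrow> A x \<inter> A y = {}"
        using missing_one_disjoint[of _ X _ n] unfolding A_def by blast
    qed
    moreover have "(n - t - 3) * ?f \<le> card (A x)" if x: "x \<in> X" for x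
    proof -
      have "card (insert v (X - {x})) = t + 2"
        using v(2) fin(1) X(2) x by simp
      then have "card {F \<in> Sigma_perms n. insert v (X - {x}) \<subseteq> F} \<le> ?f"
        using card_supersets_le[of n "insert v (X - {x})"] by simp
      moreover have "card (missing_one n X x) - card {F \<in> Sigma_perms n. insert v (X - {x}) \<subseteq> F} \<le> card (A x)"
        unfolding A_def by (rule diff_card_le_card_Diff) simp
      ultimately have "(n - t - 2) * ?f - ?f \<le> card (A x)"
        unfolding card_missing_one[OF X x] by linarith
      moreover have "n - t - 2 = Suc (n - t - 3)"
        using n by simp
      then have "(n - t - 3) * ?f = (n - t - 2) * ?f - ?f"
        by (metis diff_add_inverse mult_Suc)
      ultimately show ?thesis
        by simp
    qed
    then have "(\<Sum>x\<in>X. (n - t - 3) * ?f) \<le> (\<Sum>x\<in>X. card (A x))"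
      by (intro sum_mono)
    moreover have "t * (n - t - 2) * ?f \<le> (\<Sum>x\<in>X. (n - t - 3) * ?f)"
    proof -
      obtain d where "n = 3 * t + 6 + d"
        using n le_iff_add by blast
      then have "t * (n - t - 2) \<le> (t + 2) * (n - t - 3)"
        by (simp add: algebra_simps)
      then show ?thesis
        unfolding sum_constant X(2) of_nat_id by (metis mult.assoc mult_le_mono1)
    qed
    ultimately show ?thesis
      by linarith
  qed
  show ?thesis
  proof (rule antisym)
    obtain T where T: "T \<subseteq> X" "card T = t"
      using obtain_subset_with_card_n[of t X] X(2) by auto
    show "star_diversity n t \<F> \<le> t * (n - t - 2) * ?f"
      using star_diversity_le[OF partial_permutation_subset[OF X(1) T(1)] T(2), of \<F>] inside[OF T] by simp
    obtain T' where T': "card T' = t" "star_diversity n t \<F> = card {F \<in> \<F>. \<not> T' \<subseteq> F}"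
      using star_diversity_attained[of t n \<F>] n by auto
    then show "t * (n - t - 2) * ?f \<le> star_diversity n t \<F>"
      using inside[of T'] outside[of T'] by (cases "T' \<subseteq> X") auto
  qed
qed

lemma star_diversity_near_supersets:
  assumes t: "1 \<le> t" and X: "partial_permutation n X" "card X = t + 2"
    and \<F>: "\<F> \<subseteq> {F \<in> Sigma_perms n. t + 1 \<le> card (F \<inter> X)}"
  shows "star_diversity n t \<F> \<le> t * (n - t - 2) * fact (n - t - 2)"
    and "star_diversity n t \<F> = t * (n - t - 2) * fact (n - t - 2) \<Longrightarrow>
      {F \<in> Sigma_perms n. card (F \<inter> X) = t + 1} \<subseteq> \<F>"
proof -
  let ?D = "t * (n - t - 2) * fact (n - t - 2)"
  have fin: "finite X"
    using X(1) by (rule partial_permutation_finite)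
  have sub: "{F \<in> \<F>. \<not> T \<subseteq> F} \<subseteq> (\<Union>x\<in>T. missing_one n X x)"
    "finite (\<Union>x\<in>T. missing_one n X x)" "card (\<Union>x\<in>T. missing_one n X x) = ?D"
    "star_diversity n t \<F> \<le> card {F \<in> \<F>. \<not> T \<subseteq> F}"
    if T: "T \<subseteq> X" "card T = t" for T
  proof -
    show "{F \<in> \<F>. \<not> T \<subseteq> F} \<subseteq> (\<Union>x\<in>T. missing_one n X x)"
      using \<F> near_supersets_outside[OF X T(1)] by blast
    show "finite (\<Union>x\<in>T. missing_one n X x)"
      using fin finite_subset[OF T(1)] by auto
    show "card (\<Union>x\<in>T. missing_one n X x) = ?D"
      using card_UN_missing_one[OF X T(1)] T(2) by simp
    show "star_diversity n t \<F> \<le> card {F \<in> \<F>. \<not> T \<subseteq> F}"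
      using partial_permutation_subset[OF X(1) T(1)] T(2) by (rule star_diversity_le)
  qed
  obtain T where T: "T \<subseteq> X" "card T = t"
    using obtain_subset_with_card_n[of t X] X(2) by auto
  show "star_diversity n t \<F> \<le> ?D"
    using sub[OF T] card_mono[of "\<Union>x\<in>T. missing_one n X x" "{F \<in> \<F>. \<not> T \<subseteq> F}"] by linarith
  assume eq: "star_diversity n t \<F> = ?D"
  have "missing_one n X x \<subseteq> \<F>" if x: "x \<in> X" for x
  proof -
    \<comment> \<open>Equality must hold for every \<open>t\<close>-subset of \<open>X\<close>, and
      since t >= 1 each \<open>x\<close> lies in one; so every layer is contained in \<F>.\<close>
    have "t - 1 \<le> card (X - {x})"
      using X(2) x fin by simp
    then obtain T' where T': "T' \<subseteq> X - {x}" "card T' = t - 1" "finite T'"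
      by (rule obtain_subset_with_card_n)
    define T where "T = insert x T'"
    have T: "T \<subseteq> X" "card T = t" "x \<in> T"
      using T' x t unfolding T_def by (auto simp: card_insert_if)
    have "{F \<in> \<F>. \<not> T \<subseteq> F} = (\<Union>x\<in>T. missing_one n X x)"
      using sub[OF T(1,2)] eq by (intro card_seteq) auto
    then show ?thesis
      using T(3) by blast
  qed
  then show "{F \<in> Sigma_perms n. card (F \<inter> X) = t + 1} \<subseteq> \<F>"
    unfolding level_eq_UN_missing_one[OF fin X(2)] by blast
qed

section \<open>The cost of a member far from \<open>X\<close>\<close>

lemma card_containing_intersecting_le:
  assumes \<F>: "\<F> \<subseteq> Sigma_perms n" "t_intersecting t \<F>" and F0: "F0 \<in> \<F>"
    and C: "partial_permutation n C" "card C + 3 \<le> n" "card (F0 \<inter> C) < t"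
  shows "3 * card (containing \<F> C) \<le> 2 * fact (n - card C)"
proof -
  let ?A = "{G \<in> Sigma_perms n. C \<subseteq> G \<and> G \<inter> F0 \<subseteq> C}"
  have "containing \<F> C \<subseteq> {G \<in> Sigma_perms n. C \<subseteq> G} - ?A"
  proof
    fix F assume "F \<in> containing \<F> C"
    then have F: "F \<in> \<F>" "F \<in> Sigma_perms n" "C \<subseteq> F"
      using \<F>(1) unfolding containing_def by auto
    have "\<not> F \<inter> F0 \<subseteq> C"
    proof
      assume "F \<inter> F0 \<subseteq> C"
      then have "card (F \<inter> F0) \<le> card (F0 \<inter> C)"
        using partial_permutation_finite[OF C(1)] by (intro card_mono) auto
      moreover have "t \<le> card (F \<inter> F0)"
        using \<F>(2) F(1) F0 unfolding t_intersecting_def by blast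
      ultimately show False
        using C(3) by linarith
    qed
    then show "F \<in> {G \<in> Sigma_perms n. C \<subseteq> G} - ?A"
      using F by blast
  qed
  then have "card (containing \<F> C) \<le> card ({G \<in> Sigma_perms n. C \<subseteq> G} - ?A)"
    by (intro card_mono) auto
  also have "\<dots> = fact (n - card C) - card ?A"
    using card_supersets[OF C(1)] by (subst card_Diff_subset) auto
  finally have "card (containing \<F> C) \<le> fact (n - card C) - card ?A" .
  moreover have "fact (n - card C) \<le> 3 * card ?A"
    using \<F>(1) F0 C by (intro card_avoiding_ge) auto
  ultimately show ?thesis
    by linarith
qed

text \<open>The star \<open>T\<close> is chosen through a cell \<open>z\<close> for which
  \<open>F0\<close> meets \<open>X - {z}\<close> in fewer than \<open>t\<close> cells. It omits the
  far members, \<open>t - 1\<close> possibly full layers, and the layer of \<open>z\<close>, which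
  \<open>F0\<close> cuts down to at most 2/3 of (n-t-1)!.\<close>

lemma star_diversity_lt_if_stray:
  assumes t: "1 \<le> t" and n: "t + 8 \<le> n"
    and \<F>: "\<F> \<subseteq> Sigma_perms n" "t_intersecting t \<F>"
    and X: "partial_permutation n X" "card X = t + 2"
    and rest: "card {F \<in> \<F>. card (F \<inter> X) \<le> t} \<le> fact (n - t - 2)"
    and F0: "F0 \<in> \<F>" "card (F0 \<inter> X) \<le> t"
  shows "star_diversity n t \<F> < t * (n - t - 2) * fact (n - t - 2)"
proof -
  let ?f = "fact (n - t - 2) :: nat"
  have fin: "finite X" "finite \<F>"
    using X(1) partial_permutation_finite finite_subset[OF \<F>(1)] by auto
  have "\<exists>z\<in>X. card (F0 \<inter> (X - {z})) < t"
  proof (cases "F0 \<inter> X = {}")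
    case True
    moreover have "X \<noteq> {}"
      using X(2) by auto
    ultimately show ?thesis
      using t by (metis Int_Diff all_not_in_conv card.empty empty_Diff less_le_trans zero_less_one)
  next
    case False
    then obtain z where "z \<in> F0 \<inter> X"
      by auto
    moreover from this have "card (F0 \<inter> X - {z}) < card (F0 \<inter> X)"
      using fin(1) by (intro card_Diff1_less) auto
    ultimately show ?thesis
      using F0(2) by (metis IntD2 Int_Diff less_le_trans)
  qed
  then obtain z where z: "z \<in> X" "card (F0 \<inter> (X - {z})) < t"
    by auto
  have cz: "card (X - {z}) = t + 1"
    using z(1) X(2) fin(1) by simp
  have above: "3 * card (containing \<F> (X - {z})) \<le> 2 * fact (n - t - 1)"
    using card_containing_intersecting_le[OF \<F> F0(1) partial_permutation_subset[OF X(1)], of "X - {z}"] z(2) cz n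
    by simp
  obtain T' where T': "T' \<subseteq> X - {z}" "card T' = t - 1"
    using obtain_subset_with_card_n[of "t - 1" "X - {z}"] cz by force
  define T where "T = insert z T'"
  have finT': "finite T'"
    using T'(1) fin(1) finite_subset by blast
  have T: "T \<subseteq> X" "card T = t"
    using T' z(1) t finT' unfolding T_def by (auto simp: card_insert_if)
  have "{F \<in> \<F>. \<not> T \<subseteq> F} \<subseteq> {F \<in> \<F>. card (F \<inter> X) \<le> t} \<union> (\<Union>x\<in>T'. missing_one n X x) \<union> containing \<F> (X - {z})"
  proof
    fix F assume F: "F \<in> {F \<in> \<F>. \<not> T \<subseteq> F}"
    show "F \<in> {F \<in> \<F>. card (F \<inter> X) \<le> t} \<union> (\<Union>x\<in>T'. missing_one n X x) \<union> containing \<F> (X - {z})"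
    proof (cases "card (F \<inter> X) \<le> t")
      case False
      then have "F \<in> (\<Union>x\<in>T. missing_one n X x)"
        using near_supersets_outside[OF X T(1)] F \<F>(1) by auto
      then show ?thesis
        using F unfolding T_def containing_def missing_one_def by blast
    qed (use F in auto)
  qed
  then have "card {F \<in> \<F>. \<not> T \<subseteq> F}
      \<le> card ({F \<in> \<F>. card (F \<inter> X) \<le> t} \<union> (\<Union>x\<in>T'. missing_one n X x) \<union> containing \<F> (X - {z}))"
    using fin finT' by (intro card_mono) (auto simp: containing_def)
  also have "\<dots> \<le> card {F \<in> \<F>. card (F \<inter> X) \<le> t} + card (\<Union>x\<in>T'. missing_one n X x)
      + card (containing \<F> (X - {z}))"
    by (intro order_trans[OF card_Un_le] add_right_mono card_Un_le)
  also have "\<dots> \<le> ?f + (t - 1) * (n - t - 2) * ?f + card (containing \<F> (X - {z}))"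
  proof -
    have "T' \<subseteq> X"
      using T'(1) by auto
    then show ?thesis
      using rest card_UN_missing_one[OF X, of T'] T'(2) by simp
  qed
  finally have "3 * card {F \<in> \<F>. \<not> T \<subseteq> F} \<le> 3 * ?f + 3 * ((t - 1) * (n - t - 2) * ?f) + 2 * fact (n - t - 1)"
    using above by linarith
  also have "\<dots> < 3 * (t * (n - t - 2) * ?f)"
  proof -
    obtain u d where ud: "t = Suc u" "n = t + 8 + d"
      using t n by (metis Suc_le_D le_iff_add One_nat_def)
    have "fact (n - t - 1) = (n - t - 1) * ?f"
      using fact_reduce[of "n - t - 1", where 'a = nat] n by simp
    then have "3 * ?f + 3 * ((t - 1) * (n - t - 2) * ?f) + 2 * fact (n - t - 1)
        = (3 + 3 * ((t - 1) * (n - t - 2)) + 2 * (n - t - 1)) * ?f"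
      by (simp only: distrib_right mult.assoc)
    \<comment> \<open>With N = n-t-2 this amounts to 5 + 2N < 3N, that is N >= 6, hence the
      hypothesis n >= t+8.\<close>
    also have "\<dots> < 3 * (t * (n - t - 2)) * ?f"
      unfolding ud by (intro mult_strict_right_mono) (simp_all add: algebra_simps)
    finally show ?thesis
      by (simp only: mult.assoc)
  qed
  finally have "card {F \<in> \<F>. \<not> T \<subseteq> F} < t * (n - t - 2) * ?f"
    by linarith
  then show ?thesis
    using star_diversity_le[OF partial_permutation_subset[OF X(1) T(1)] T(2), of \<F>] by linarith
qed

theorem theorem1p6:
  fixes n t :: nat and \<F> :: "(nat \<times> nat) set set"
  assumes "t \<ge> 1"
    and "n \<ge> 6 * (t + 4) ^ 4"
    and "\<F> \<subseteq> Sigma_perms n"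
    and "t_intersecting t \<F>"
  shows "star_diversity n t \<F> \<le> t * (n - t - 2) * fact (n - t - 2) \<and>
    (star_diversity n t \<F> = t * (n - t - 2) * fact (n - t - 2) \<longleftrightarrow>
      (\<exists>X. partial_permutation n X \<and> card X = t + 2 \<and>
        {F \<in> Sigma_perms n. card (F \<inter> X) = t + 1} \<subseteq> \<F> \<and>
        \<F> \<subseteq> {F \<in> Sigma_perms n. card (F \<inter> X) \<ge> t + 1}))"
    (is "?sd \<le> ?D \<and> (?sd = ?D \<longleftrightarrow> ?extremal)")
proof -
  have n: "3 * t + 6 \<le> n" "t + 8 \<le> n"
    using size_bounds(1)[OF assms(1,2)] by (simp_all add: power2_eq_square)
  have finF: "finite \<F>"
    using assms(3) finite_subset by fastforce
  have extremal: "?sd = ?D" if ?extremal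
    using that star_diversity_extremal[OF assms(1) n(1)] by blast
  obtain \<S> where \<S>: "\<And>S. S \<in> \<S> \<Longrightarrow> partial_permutation n S" "\<And>S. S \<in> \<S> \<Longrightarrow> card S \<le> 6 * t + 11"
    "\<And>S S'. S \<in> \<S> \<Longrightarrow> S' \<in> \<S> \<Longrightarrow> t \<le> card (S \<inter> S')"
    and rest: "card {F \<in> \<F>. \<forall>S\<in>\<S>. \<not> S \<subseteq> F} \<le> fact (n - t - 2)"
    using kernel_family[OF assms] by blast
  consider T where "partial_permutation n T" "card T = t"
      "card (upset n {S \<in> \<S>. \<not> T \<subseteq> S}) + fact (n - t - 2) < ?D"
    | X where "partial_permutation n X" "card X = t + 2" "\<forall>S\<in>\<S>. t + 1 \<le> card (S \<inter> X)"
    using intersecting_structure[of \<S> n t, OF \<S> assms(1,2)] by blast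
  \<comment> \<open>Strict inequality also settles the equivalence, since an extremal family attains
    the bound; otherwise all of \<F> lies above some \<open>X\<close> and no approximation
    remains.\<close>
  then have "?sd < ?D \<or> (\<exists>X. partial_permutation n X \<and> card X = t + 2 \<and>
      \<F> \<subseteq> {F \<in> Sigma_perms n. t + 1 \<le> card (F \<inter> X)})"
  proof cases
    case T: (1 T)
    have "{F \<in> \<F>. \<not> T \<subseteq> F} \<subseteq> upset n {S \<in> \<S>. \<not> T \<subseteq> S} \<union> {F \<in> \<F>. \<forall>S\<in>\<S>. \<not> S \<subseteq> F}"
      using assms(3) unfolding upset_def by blast
    then have "card {F \<in> \<F>. \<not> T \<subseteq> F} \<le> card (upset n {S \<in> \<S>. \<not> T \<subseteq> S} \<union> {F \<in> \<F>. \<forall>S\<in>\<S>. \<not> S \<subseteq> F})"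
      using finF by (intro card_mono) auto
    also have "\<dots> \<le> card (upset n {S \<in> \<S>. \<not> T \<subseteq> S}) + card {F \<in> \<F>. \<forall>S\<in>\<S>. \<not> S \<subseteq> F}"
      by (rule card_Un_le)
    finally show ?thesis
      using star_diversity_le[OF T(1,2), of \<F>] T(3) rest by linarith
  next
    case X: (2 X)
    have fin: "finite X"
      using X(1) by (rule partial_permutation_finite)
    have big: "t + 1 \<le> card (F \<inter> X)" if "S \<in> \<S>" "S \<subseteq> F" for S F
    proof -
      have "card (S \<inter> X) \<le> card (F \<inter> X)"
        using that(2) fin by (intro card_mono) auto
      then show ?thesis
        using X(3) that(1) by fastforce
    qed
    have "{F \<in> \<F>. card (F \<inter> X) \<le> t} \<subseteq> {F \<in> \<F>. \<forall>S\<in>\<S>. \<not> S \<subseteq> F}"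
    proof
      fix F assume F: "F \<in> {F \<in> \<F>. card (F \<inter> X) \<le> t}"
      have "\<not> S \<subseteq> F" if "S \<in> \<S>" for S
        using big[OF that, of F] F by auto
      then show "F \<in> {F \<in> \<F>. \<forall>S\<in>\<S>. \<not> S \<subseteq> F}"
        using F by blast
    qed
    then have "card {F \<in> \<F>. card (F \<inter> X) \<le> t} \<le> card {F \<in> \<F>. \<forall>S\<in>\<S>. \<not> S \<subseteq> F}"
      using finF by (intro card_mono) auto
    then have rest': "card {F \<in> \<F>. card (F \<inter> X) \<le> t} \<le> fact (n - t - 2)"
      using rest by linarith
    show ?thesis
    proof (cases "\<exists>F0\<in>\<F>. card (F0 \<inter> X) \<le> t")
      case True
      then show ?thesis
        using star_diversity_lt_if_stray[OF assms(1) n(2) assms(3,4) X(1,2) rest'] by blast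
    next
      case False
      then have "\<F> \<subseteq> {F \<in> Sigma_perms n. t + 1 \<le> card (F \<inter> X)}"
        using assms(3) by (auto simp: not_le Suc_le_eq)
      then show ?thesis
        using X(1,2) by blast
    qed
  qed
  then show ?thesis
  proof (elim disjE exE conjE)
    assume "?sd < ?D"
    then show ?thesis
      using extremal by fastforce
  next
    fix X assume X: "partial_permutation n X" "card X = t + 2"
      "\<F> \<subseteq> {F \<in> Sigma_perms n. t + 1 \<le> card (F \<inter> X)}"
    show ?thesis
    proof (intro conjI iffI)
      show "?sd \<le> ?D"
        by (rule star_diversity_near_supersets(1)[OF assms(1) X])
      show ?extremal if "?sd = ?D"
        using X star_diversity_near_supersets(2)[OF assms(1) X that] by blast
    qed (rule extremal)
  qed
qed

end
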